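(* Let $P_{ac}(\mathbb{R})$ be the set of Borel probability measures on $\mathbb{R}$ that are absolutely continuous with respect to Lebesgue measure, and let $\phi\colon P_{ac}(\mathbb{R})\to P_{ac}(\mathbb{R})$ be a surjective map with $d_{Ku}(\phi(\mu),\phi(\nu))=d_{Ku}(\mu,\nu)$ for all $\mu,\nu\in P_{ac}(\mathbb{R})$. Then there exist a bijection $g\colon\mathbb{R}\to\mathbb{R}$ such that $g$ and $g^{-1}$ are absolutely continuous on every compact interval, and an $x\in\mathbb{R}\cup\{\infty\}$, such that $$\phi(\mu)=\mu\circ(g\circ r_x)\qquad(\mu\in P_{ac}(\mathbb{R})).$$ Moreover, every transformation of this form is a surjective isometry of $P_{ac}(\mathbb{R})$ with respect to the Kuiper distance.
   Context: For Borel probability measures $\mu,\nu$ on $\mathbb{R}$ with distribution functions $f_\mu(t)=\mu((-\infty,t])$, the Kuiper distance is $d_{Ku}(\mu,\nu)=\sup_{t}(f_\mu(t)-f_\nu(t))+\sup_t(f_\nu(t)-f_\mu(t))$, which equals $\sup\{|\mu(I)-\nu(I)|: I\subseteq\mathbb{R}\text{ a non-degenerate interval}\}$. For $x\in\mathbb{R}$, $r_x\colon\mathbb{R}\setminus\{x\}\to\mathbb{R}$ is $r_x(t)=1/(t-x)$, and $r_\infty\colon\mathbb{R}\to\mathbb{R}$ is the identity. If $A$ is a Borel set and $G\colon A\to\mathbb{R}$ is injective and maps Borel sets to Borel sets, then $\mu\circ G$ denotes the Borel measure $(\mu\circ G)(B)=\mu(G(B\cap A))$ for Borel $B\subseteq\mathbb{R}$.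 *)

theory Defs
  imports "HOL-Probability.Probability"
begin

definition Pac :: "real measure set" where
  "Pac = {\<mu>. sets \<mu> = sets borel \<and> prob_space \<mu> \<and> absolutely_continuous lborel \<mu>}"

definition distr_fun :: "real measure \<Rightarrow> real \<Rightarrow> real" where
  "distr_fun \<mu> t = measure \<mu> {..t}"

definition kuiper :: "real measure \<Rightarrow> real measure \<Rightarrow> real" where
  "kuiper \<mu> \<nu> = (SUP t. distr_fun \<mu> t - distr_fun \<nu> t) + (SUP t. distr_fun \<nu> t - distr_fun \<mu> t)"

definition abs_cont_on :: "(real \<Rightarrow> real) \<Rightarrow> real set \<Rightarrow> bool" where
  "abs_cont_on f S \<longleftrightarrow>
     (\<forall>\<epsilon>>0. \<exists>\<delta>>0. \<forall>(n::nat) a b.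
        (\<forall>i<n. a i \<le> b i \<and> {a i..b i} \<subseteq> S) \<and>
        (\<forall>i<n. \<forall>j<n. i \<noteq> j \<longrightarrow> {a i<..<b i} \<inter> {a j<..<b j} = {}) \<and>
        (\<Sum>i<n. b i - a i) < \<delta>
        \<longrightarrow> (\<Sum>i<n. \<bar>f (b i) - f (a i)\<bar>) < \<epsilon>)"

text \<open>The maps r_x; the point at infinity is represented by None.\<close>
definition r_map :: "real option \<Rightarrow> real \<Rightarrow> real" where
  "r_map x t = (case x of None \<Rightarrow> t | Some y \<Rightarrow> 1 / (t - y))"

definition r_dom :: "real option \<Rightarrow> real set" where
  "r_dom x = (case x of None \<Rightarrow> UNIV | Some y \<Rightarrow> UNIV - {y})"

definition comp_measure :: "real measure \<Rightarrow> real set \<Rightarrow> (real \<Rightarrow> real) \<Rightarrow> real measure" where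
  "comp_measure \<mu> A G = measure_of UNIV (sets borel) (\<lambda>B. emeasure \<mu> (G ` (B \<inter> A)))"

end

(* An absolutely continuous measure has no atoms, so the Kuiper distance is the supremum of
   |mu(I) - nu(I)| over the arcs I of the circle R + {infinity}, and it is attained. Distance 1
   means that an arc carries mu and misses nu. The pairs (mu, nu) at distance 1 such that everything
   at distance 1 from mu is at distance 1 from everything at distance 1 from nu are exactly those
   with mu of full support on an arc and nu of full support on the complementary arc. Hence an
   isometry maps the measures carried by an arc I onto the measures carried by an arc I', and as the
   distance from mu to the former is 1 - mu(I), also phi(mu)(I') = mu(I). The images of the rays
   {..t} are nested arcs whose differences are arcs, so all of them share an endpoint x;
   sending x to infinity turns them into rays, whose other endpoints define the homeomorphism. *)
theory Submission
  imports Defs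
begin

section \<open>The Kuiper distance and distribution functions\<close>

text \<open>Distance 1 alone does not determine an arc: a measure with gaps in its support can be
  separated from another one by many arcs. The closure condition on the pair removes the gaps, and
  as it speaks of distances only, an isometry preserves it. Measures see sets only up to null sets;
  taking all arcs open on the left and closed on the right turns identities between masses of arcs,
  valid for every measure in \<open>Pac\<close>, into identities between sets. The regularity of the
  homeomorphism \<open>h\<close> comes from surjectivity: \<open>h\<close> and its inverse both push
  \<open>Pac\<close> into itself, so preimages of null sets are null. For a monotone bijection this
  is equivalent to absolute continuity of its inverse on compact intervals, in one direction by the
  epsilon-delta form of absolute continuity of a measure, in the other by Luzin's condition (N). The
  converse half of the theorem uses that the distance is the oscillation over the circle of the
  difference of the distribution functions, extended by 0 at infinity.\<close>

lemma Pac_sets: "\<mu> \<in> Pac \<Longrightarrow> sets \<mu> = sets borel"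
  by (simp add: Pac_def)

lemma Pac_space: "\<mu> \<in> Pac \<Longrightarrow> space \<mu> = UNIV"
  using sets_eq_imp_space_eq[of \<mu> borel] by (simp add: Pac_def)

lemma Pac_prob: "\<mu> \<in> Pac \<Longrightarrow> prob_space \<mu>"
  by (simp add: Pac_def)

lemma Pac_real_distribution: "\<mu> \<in> Pac \<Longrightarrow> real_distribution \<mu>"
  by (simp add: Pac_def real_distribution_def real_distribution_axioms_def)

lemma Pac_null: "\<mu> \<in> Pac \<Longrightarrow> N \<in> null_sets lborel \<Longrightarrow> measure \<mu> N = 0"
  by (auto simp: Pac_def absolutely_continuous_def measure_def null_sets_def)

lemma PacI:
  assumes "sets \<mu> = sets borel" "prob_space \<mu>"
    and "\<And>N. N \<in> null_sets lborel \<Longrightarrow> emeasure \<mu> N = 0"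
  shows "\<mu> \<in> Pac"
  using assms by (auto simp: Pac_def absolutely_continuous_def null_sets_def)

lemma Pac_singleton: "\<mu> \<in> Pac \<Longrightarrow> measure \<mu> {x} = 0"
  by (rule Pac_null) auto

text \<open>Lets endpoints and poles be ignored when masses are compared.\<close>

lemma measure_cong_off_null:
  assumes "\<mu> \<in> Pac" "N \<in> null_sets lborel" "A \<in> sets borel" "B \<in> sets borel"
    and "\<And>x. x \<notin> N \<Longrightarrow> x \<in> A \<longleftrightarrow> x \<in> B"
  shows "measure \<mu> A = measure \<mu> B"
proof -
  interpret prob_space \<mu> using assms(1) by (rule Pac_prob)
  have "N \<in> null_sets \<mu>"
    using assms by (auto simp: Pac_def absolutely_continuous_def)
  then have "AE x in \<mu>. x \<notin> N" by (rule AE_not_in)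
  then have "AE x in \<mu>. x \<in> A \<longleftrightarrow> x \<in> B"
    by eventually_elim (use assms(5) in auto)
  then show ?thesis
    by (intro finite_measure_eq_AE) (use assms Pac_sets in auto)
qed

text \<open>Outside a compact interval the function stays below \<open>D t0\<close>, so the maximum
  over that interval is global. The positive value ensures that the supremum is not merely
  approached at infinity.\<close>

lemma continuous_attains_max:
  fixes D :: "real \<Rightarrow> real"
  assumes "continuous_on UNIV D" "(D \<longlongrightarrow> 0) at_top" "(D \<longlongrightarrow> 0) at_bot" "D t0 > 0"
  shows "\<exists>t. \<forall>s. D s \<le> D t"
proof -
  obtain u where u: "\<And>s. s \<ge> u \<Longrightarrow> D s < D t0"
    using order_tendstoD(2)[OF assms(2,4)] by (auto simp: eventually_at_top_linorder)
  obtain l where l: "\<And>s. s \<le> l \<Longrightarrow> D s < D t0"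
    using order_tendstoD(2)[OF assms(3,4)] by (auto simp: eventually_at_bot_linorder)
  have t0: "t0 \<in> {l..u}"
    using u[of t0] l[of t0] by (meson atLeastAtMost_iff less_irrefl linear)
  obtain t where "t \<in> {l..u}" and t: "\<And>s. s \<in> {l..u} \<Longrightarrow> D s \<le> D t"
    using continuous_attains_sup[of "{l..u}" D] t0 assms(1) continuous_on_subset by blast
  have "D s \<le> D t" for s
  proof (cases "s \<in> {l..u}")
    case False
    then have "D s < D t0" using u[of s] l[of s] by auto
    with t[OF t0] show ?thesis by simp
  qed (rule t)
  then show ?thesis by blast
qed

context
  fixes \<mu> \<nu> :: "real measure" and D :: "real \<Rightarrow> real"
  assumes Pac: "\<mu> \<in> Pac" "\<nu> \<in> Pac"
  defines "D \<equiv> \<lambda>t. distr_fun \<mu> t - distr_fun \<nu> t"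
begin

lemma distr_fun_diff_continuous: "continuous_on UNIV D"
proof -
  have "continuous_on UNIV (distr_fun m)" if "m \<in> Pac" for m
  proof -
    interpret real_distribution m using that by (rule Pac_real_distribution)
    have "distr_fun m = cdf m" by (auto simp: distr_fun_def cdf_def)
    then show ?thesis
      using isCont_cdf Pac_singleton[OF that] by (simp add: continuous_on_eq_continuous_at)
  qed
  then show ?thesis unfolding D_def using Pac by (intro continuous_intros) auto
qed

lemma distr_fun_diff_tendsto: "(D \<longlongrightarrow> 0) at_top" "(D \<longlongrightarrow> 0) at_bot"
proof -
  interpret m: real_distribution \<mu> using Pac(1) by (rule Pac_real_distribution)
  interpret n: real_distribution \<nu> using Pac(2) by (rule Pac_real_distribution)
  have "D = (\<lambda>t. cdf \<mu> t - cdf \<nu> t)" by (auto simp: distr_fun_def cdf_def D_def)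
  then show "(D \<longlongrightarrow> 0) at_top" "(D \<longlongrightarrow> 0) at_bot"
    using tendsto_diff[OF m.cdf_lim_at_top_prob n.cdf_lim_at_top_prob]
      tendsto_diff[OF m.cdf_lim_at_bot n.cdf_lim_at_bot] by auto
qed

lemma distr_fun_diff_bounded: "\<bar>D t\<bar> \<le> 1"
proof -
  have "0 \<le> distr_fun m t" "distr_fun m t \<le> 1" if "m \<in> Pac" for m
    using prob_space.prob_le_1[OF Pac_prob[OF that]] by (auto simp: distr_fun_def)
  from this[OF Pac(1)] this[OF Pac(2)] show ?thesis by (simp add: D_def)
qed

lemma distr_fun_diff_bdd: "bdd_above (range D)" "bdd_above (range (\<lambda>t. - D t))"
  using distr_fun_diff_bounded by (auto intro!: bdd_aboveI2[of _ _ 1] simp: abs_le_iff minus_le_iff)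

lemma kuiper_eq_osc: "kuiper \<mu> \<nu> = (SUP t. D t) + (SUP t. - D t)"
  by (simp add: kuiper_def D_def)

lemma SUP_distr_fun_diff_nonneg: "0 \<le> (SUP t. D t)" "0 \<le> (SUP t. - D t)"
proof -
  have "\<And>t. D t \<le> (SUP t. D t)" "\<And>t. - D t \<le> (SUP t. - D t)"
    using distr_fun_diff_bdd by (auto intro!: cSUP_upper)
  then show "0 \<le> (SUP t. D t)" "0 \<le> (SUP t. - D t)"
    using tendsto_upperbound[OF distr_fun_diff_tendsto(1)]
      tendsto_upperbound[OF tendsto_minus[OF distr_fun_diff_tendsto(1)]]
    by auto
qed

text \<open>\<open>kuiper\<close> is the oscillation of \<open>D\<close> over the circle, with value
  0 at infinity. The first bound compares a point with infinity, the second compares two finite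
  points.\<close>

lemma kuiper_ge: "\<bar>D t\<bar> \<le> kuiper \<mu> \<nu>" "\<bar>D t - D s\<bar> \<le> kuiper \<mu> \<nu>"
proof -
  have *: "\<And>t. D t \<le> (SUP t. D t)" "\<And>t. - D t \<le> (SUP t. - D t)"
    using distr_fun_diff_bdd by (auto intro!: cSUP_upper)
  show "\<bar>D t\<bar> \<le> kuiper \<mu> \<nu>" "\<bar>D t - D s\<bar> \<le> kuiper \<mu> \<nu>"
    using *[of t] *[of s] SUP_distr_fun_diff_nonneg by (auto simp: kuiper_eq_osc)
qed

text \<open>Each of the two suprema is either 0, the value at infinity, or a maximum on the line.
  The cases differ in how many of the extremal points are finite.\<close>

lemma kuiper_attained:
  obtains "kuiper \<mu> \<nu> = 0" | t where "kuiper \<mu> \<nu> = \<bar>D t\<bar>"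
    | t s where "kuiper \<mu> \<nu> = D t - D s"
proof -
  have 1: "(SUP t. D t) = 0 \<or> (\<exists>t. (SUP t. D t) = D t)"
  proof (cases "\<exists>t0. D t0 > 0")
    case True
    then obtain t where "\<And>s. D s \<le> D t"
      using continuous_attains_max[OF distr_fun_diff_continuous distr_fun_diff_tendsto] by blast
    then have "(SUP t. D t) = D t" by (intro cSup_eq_maximum) auto
    then show ?thesis by blast
  next
    case False
    then have "(SUP t. D t) \<le> 0" by (intro cSUP_least) (auto simp: not_less)
    then show ?thesis using SUP_distr_fun_diff_nonneg by auto
  qed
  have 2: "(SUP t. - D t) = 0 \<or> (\<exists>t. (SUP t. - D t) = - D t)"
  proof (cases "\<exists>t0. - D t0 > 0")
    case True
    then obtain t0 where "- D t0 > 0" by blast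
    moreover have "continuous_on UNIV (\<lambda>t. - D t)" "((\<lambda>t. - D t) \<longlongrightarrow> 0) at_top" "((\<lambda>t. - D t) \<longlongrightarrow> 0) at_bot"
      using distr_fun_diff_continuous distr_fun_diff_tendsto[THEN tendsto_minus]
      by (auto intro: continuous_intros)
    ultimately obtain t where "\<And>s. - D s \<le> - D t"
      using continuous_attains_max[of "\<lambda>t. - D t" t0] by blast
    then have "(SUP t. - D t) = - D t" by (intro cSup_eq_maximum) auto
    then show ?thesis by blast
  next
    case False
    then have "(SUP t. - D t) \<le> 0" by (intro cSUP_least) (auto simp: not_less)
    then show ?thesis using SUP_distr_fun_diff_nonneg by auto
  qed
  have "kuiper \<mu> \<nu> = 0 \<or> (\<exists>t. kuiper \<mu> \<nu> = \<bar>D t\<bar>) \<or> (\<exists>t s. kuiper \<mu> \<nu> = D t - D s)"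
  proof -
    consider "(SUP t. D t) = 0" "(SUP t. - D t) = 0"
      | t where "(SUP t. D t) = D t" "(SUP t. - D t) = 0"
      | t where "(SUP t. D t) = 0" "(SUP t. - D t) = - D t"
      | t s where "(SUP t. D t) = D t" "(SUP t. - D t) = - D s"
      using 1 2 by blast
    then show ?thesis
    proof cases
      case (2 t)
      then have "kuiper \<mu> \<nu> = \<bar>D t\<bar>"
        using SUP_distr_fun_diff_nonneg by (simp add: kuiper_eq_osc)
      then show ?thesis by blast
    next
      case (3 t)
      then have "kuiper \<mu> \<nu> = \<bar>D t\<bar>"
        using SUP_distr_fun_diff_nonneg by (simp add: kuiper_eq_osc)
      then show ?thesis by blast
    next
      case (4 t s)
      then have "kuiper \<mu> \<nu> = D t - D s" by (simp add: kuiper_eq_osc)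
      then show ?thesis by blast
    qed (simp add: kuiper_eq_osc)
  qed
  then show thesis using that by blast
qed

end

lemma kuiper_commute: "kuiper \<mu> \<nu> = kuiper \<nu> \<mu>"
  by (simp add: kuiper_def add.commute)

lemma kuiper_self: "kuiper \<mu> \<mu> = 0"
  by (simp add: kuiper_def)

section \<open>Arcs of the circle\<close>

text \<open>The nondegenerate proper arcs of the circle, open at the initial and closed at the final
  point, with infinity left out. The four shapes correspond to infinity lying off the arc, inside
  it, at its end or at its beginning. The convention makes the family closed under exact
  complements.\<close>

definition arcs :: "real set set" where
  "arcs = {S. \<exists>a b. a < b \<and> (S = {a<..b} \<or> S = - {a<..b})} \<union> {S. \<exists>a. S = {a<..} \<or> S = {..a}}"

lemma arcs_cases:
  assumes "S \<in> arcs"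
  obtains a b where "a < b" "S = {a<..b}" | a b where "a < b" "S = - {a<..b}"
    | a where "S = {a<..}" | a where "S = {..a}"
  using assms unfolding arcs_def by blast

lemma arcs_intros:
  "a < b \<Longrightarrow> {a<..b} \<in> arcs" "a < b \<Longrightarrow> - {a<..b} \<in> arcs" "{a<..} \<in> arcs" "{..a} \<in> arcs"
  unfolding arcs_def by blast+

lemma arcs_Compl: "S \<in> arcs \<Longrightarrow> - S \<in> arcs"
  by (erule arcs_cases) (auto simp: arcs_intros Compl_greaterThan Compl_atMost)

lemma arcs_borel: "S \<in> arcs \<Longrightarrow> S \<in> sets borel"
  by (erule arcs_cases) auto

lemma arcs_nonempty: "S \<in> arcs \<Longrightarrow> S \<noteq> {}"
proof (erule arcs_cases)
  fix a b assume "S = - {a<..b}"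
  then have "a \<in> S" by auto
  then show ?thesis by blast
qed auto

text \<open>The gain from the half-open convention: membership of \<open>x\<close> decides
  membership on a whole interval ending at \<open>x\<close>, so a pointwise statement about arcs can
  be tested by measures concentrated just left of \<open>x\<close>.\<close>

lemma arcs_left_constant:
  assumes "S \<in> arcs"
  shows "\<exists>y<x. {y<..x} \<subseteq> S \<or> {y<..x} \<subseteq> - S"
  using assms
proof (cases rule: arcs_cases)
  case (1 a b)
  consider "x \<le> a" | "a < x" "x \<le> b" | "b < x" by linarith
  then show ?thesis
  proof cases
    case 1
    then show ?thesis by (intro exI[of _ "x - 1"]) (auto simp: \<open>S = _\<close>)
  next
    case 2
    then show ?thesis by (intro exI[of _ a]) (auto simp: \<open>S = _\<close>)
  next
    case 3
    then show ?thesis by (intro exI[of _ b]) (auto simp: \<open>S = _\<close>)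
  qed
next
  case (2 a b)
  consider "x \<le> a" | "a < x" "x \<le> b" | "b < x" by linarith
  then show ?thesis
  proof cases
    case 1
    then show ?thesis by (intro exI[of _ "x - 1"]) (auto simp: \<open>S = _\<close>)
  next
    case 2
    then show ?thesis by (intro exI[of _ a]) (auto simp: \<open>S = _\<close>)
  next
    case 3
    then show ?thesis by (intro exI[of _ b]) (auto simp: \<open>S = _\<close>)
  qed
next
  case (3 a)
  then show ?thesis
    by (intro exI[of _ "if a < x then a else x - 1"]) auto
next
  case (4 a)
  then show ?thesis
    by (intro exI[of _ "if a < x then a else x - 1"]) auto
qed

lemma arcs_left_subset:
  assumes "S \<in> arcs" "x \<in> S"
  obtains y where "y < x" "{y<..x} \<subseteq> S"
  using arcs_left_constant[OF assms(1), of x] assms(2) by force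

text \<open>For \<open>S\<close> of positive length, a probability measure with the null sets of
  Lebesgue measure on \<open>S\<close>. Conditioning the normal distribution, instead of normalising
  length, allows unbounded \<open>S\<close>.\<close>

definition gauss :: "real set \<Rightarrow> real measure" where
  "gauss S = uniform_measure (density lborel (\<lambda>x. ennreal (std_normal_density x))) S"

lemma emeasure_std_normal_eq_0_iff:
  assumes "B \<in> sets borel"
  shows "emeasure (density lborel (\<lambda>x. ennreal (std_normal_density x))) B = 0 \<longleftrightarrow> emeasure lborel B = 0"
proof -
  have pos: "\<not> std_normal_density x \<le> 0" for x
    by (simp add: not_le normal_density_pos)
  have "emeasure (density lborel (\<lambda>x. ennreal (std_normal_density x))) B = 0
      \<longleftrightarrow> B \<in> null_sets (density lborel (\<lambda>x. ennreal (std_normal_density x)))"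
    using assms by (auto simp: null_sets_def)
  also have "\<dots> \<longleftrightarrow> (AE x in lborel. x \<in> B \<longrightarrow> ennreal (std_normal_density x) = 0)"
    using assms by (subst null_sets_density_iff) auto
  also have "\<dots> \<longleftrightarrow> (AE x in lborel. x \<notin> B)"
    using pos by (intro AE_cong) (simp add: ennreal_eq_0_iff)
  also have "\<dots> \<longleftrightarrow> emeasure lborel B = 0"
    using assms by (subst AE_iff_measurable[of B]) auto
  finally show ?thesis .
qed

context
  fixes S :: "real set"
  assumes S: "S \<in> sets borel" "emeasure lborel S \<noteq> 0"
begin

lemma gauss_Pac: "gauss S \<in> Pac"
proof (rule PacI)
  interpret prob_space "density lborel (\<lambda>x. ennreal (std_normal_density x))"
    by (rule prob_space_normal_density) simp
  show "prob_space (gauss S)"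
    unfolding gauss_def using S emeasure_std_normal_eq_0_iff
    by (intro prob_space_uniform_measure) (auto simp: emeasure_eq_measure)
  show "sets (gauss S) = sets borel" by (simp add: gauss_def)
  fix N :: "real set" assume N: "N \<in> null_sets lborel"
  then have "emeasure lborel (S \<inter> N) = 0"
    by (metis S(1) null_setsD1 null_set_Int1 sets_lborel)
  then have "emeasure (density lborel (\<lambda>x. ennreal (std_normal_density x))) (S \<inter> N) = 0"
    using N S by (subst emeasure_std_normal_eq_0_iff) auto
  then show "emeasure (gauss S) N = 0"
    unfolding gauss_def using N S by (subst emeasure_uniform_measure) auto
qed

lemma gauss_eq_0_iff:
  assumes "B \<in> sets borel"
  shows "measure (gauss S) B = 0 \<longleftrightarrow> emeasure lborel (S \<inter> B) = 0"
proof -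
  interpret prob_space "gauss S" using gauss_Pac by (rule Pac_prob)
  interpret n: prob_space "density lborel (\<lambda>x. ennreal (std_normal_density x))"
    by (rule prob_space_normal_density) simp
  have "measure (gauss S) B = 0 \<longleftrightarrow> emeasure (gauss S) B = 0"
    by (simp add: emeasure_eq_measure)
  also have "\<dots> \<longleftrightarrow> emeasure (density lborel (\<lambda>x. ennreal (std_normal_density x))) (S \<inter> B) = 0"
    unfolding gauss_def using assms S
    by (subst emeasure_uniform_measure) (auto simp: ennreal_divide_eq_0_iff n.emeasure_eq_measure)
  also have "\<dots> \<longleftrightarrow> emeasure lborel (S \<inter> B) = 0"
    using assms S by (intro emeasure_std_normal_eq_0_iff) auto
  finally show ?thesis .
qed

lemma gauss_superset:
  assumes "B \<in> sets borel" "S \<subseteq> B"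
  shows "measure (gauss S) B = 1"
proof -
  interpret real_distribution "gauss S" using gauss_Pac by (rule Pac_real_distribution)
  have "measure (gauss S) (- B) = 0"
    using assms by (subst gauss_eq_0_iff) (auto simp: Diff_eq[symmetric] Diff_eq_empty_iff[THEN iffD2])
  then show ?thesis
    using prob_compl[of B] assms by (auto simp: Compl_eq_Diff_UNIV)
qed

lemma gauss_disjoint:
  assumes "B \<in> sets borel" "S \<inter> B = {}"
  shows "measure (gauss S) B = 0"
  using assms by (subst gauss_eq_0_iff) auto

end

lemma Ioc_nonnull: "(a::real) < b \<Longrightarrow> emeasure lborel {a<..b} \<noteq> 0"
  by simp

lemma nonnull_superset:
  assumes "emeasure lborel A \<noteq> 0" "A \<subseteq> B" "B \<in> sets borel"
  shows "emeasure lborel B \<noteq> 0"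
  using assms emeasure_mono[of A B lborel] by auto

lemma arcs_nonnull:
  assumes "S \<in> arcs"
  shows "emeasure lborel S \<noteq> 0"
proof -
  obtain x where "x \<in> S" using arcs_nonempty[OF assms] by blast
  then obtain y where "y < x" "{y<..x} \<subseteq> S" using arcs_left_subset[OF assms] by blast
  then show ?thesis using nonnull_superset[OF Ioc_nonnull] arcs_borel[OF assms] by blast
qed

lemma Pac_Compl:
  assumes "\<mu> \<in> Pac" "B \<in> sets borel"
  shows "measure \<mu> (- B) = 1 - measure \<mu> B"
proof -
  interpret real_distribution \<mu> using assms(1) by (rule Pac_real_distribution)
  show ?thesis using prob_compl[of B] assms by (simp add: Compl_eq_Diff_UNIV)
qed

lemma Pac_Ioi: "\<mu> \<in> Pac \<Longrightarrow> measure \<mu> {a<..} = 1 - measure \<mu> {..a}"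
  using Pac_Compl[of \<mu> "{..a}"] by simp

lemma Pac_Ioc:
  assumes "\<mu> \<in> Pac" "a \<le> b"
  shows "measure \<mu> {a<..b} = measure \<mu> {..b} - measure \<mu> {..a}"
proof -
  interpret real_distribution \<mu> using assms(1) by (rule Pac_real_distribution)
  interpret finite_borel_measure \<mu> by (rule finite_borel_measure_M)
  show ?thesis using cdf_diff_eq[of a b] assms by (cases "a = b") (auto simp: cdf_def)
qed

section \<open>The Kuiper distance as a maximum over arcs\<close>

lemma kuiper_ge_arc:
  assumes "\<mu> \<in> Pac" "\<nu> \<in> Pac" "S \<in> arcs"
  shows "\<bar>measure \<mu> S - measure \<nu> S\<bar> \<le> kuiper \<mu> \<nu>"
  using assms(3)
proof (cases rule: arcs_cases)
  case (1 a b)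
  then show ?thesis
    using kuiper_ge(2)[OF assms(1,2), of b a] assms by (simp add: Pac_Ioc distr_fun_def algebra_simps)
next
  case (2 a b)
  then show ?thesis
    using kuiper_ge(2)[OF assms(1,2), of a b] assms
    by (simp add: Pac_Compl Pac_Ioc distr_fun_def algebra_simps)
next
  case (3 a)
  then show ?thesis
    using kuiper_ge(1)[OF assms(1,2), of a] assms by (simp add: Pac_Ioi distr_fun_def abs_minus_commute)
next
  case (4 a)
  then show ?thesis
    using kuiper_ge(1)[OF assms(1,2), of a] by (simp add: distr_fun_def)
qed

text \<open>Passing to the complementary arc changes the sign of the difference of masses, which
  disposes of the absolute value. For two finite points their order decides between an interval and
  its complement.\<close>

lemma kuiper_attained_arc:
  assumes "\<mu> \<in> Pac" "\<nu> \<in> Pac"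
  obtains "kuiper \<mu> \<nu> = 0" | S where "S \<in> arcs" "kuiper \<mu> \<nu> = measure \<mu> S - measure \<nu> S"
proof (rule kuiper_attained[OF assms])
  fix t assume *: "kuiper \<mu> \<nu> = \<bar>distr_fun \<mu> t - distr_fun \<nu> t\<bar>"
  show thesis
  proof (cases "distr_fun \<mu> t \<ge> distr_fun \<nu> t")
    case True
    then show thesis using * by (intro that(2)[of "{..t}"]) (auto simp: distr_fun_def arcs_intros)
  next
    case False
    then show thesis using * assms
      by (intro that(2)[of "{t<..}"]) (auto simp: distr_fun_def arcs_intros Pac_Ioi)
  qed
next
  fix t s assume *: "kuiper \<mu> \<nu> = distr_fun \<mu> t - distr_fun \<nu> t - (distr_fun \<mu> s - distr_fun \<nu> s)"
  consider "t = s" | "s < t" | "t < s" by linarith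
  then show thesis
  proof cases
    case 2
    then show thesis using * assms
      by (intro that(2)[of "{s<..t}"]) (auto simp: distr_fun_def arcs_intros Pac_Ioc)
  next
    case 3
    then show thesis using * assms
      by (intro that(2)[of "- {t<..s}"]) (auto simp: distr_fun_def arcs_intros Pac_Ioc Pac_Compl)
  qed (use * that(1) in simp)
qed (use that(1) in blast)

lemma kuiper_le_1:
  assumes "\<mu> \<in> Pac" "\<nu> \<in> Pac"
  shows "kuiper \<mu> \<nu> \<le> 1"
proof (rule kuiper_attained_arc[OF assms])
  fix S assume "kuiper \<mu> \<nu> = measure \<mu> S - measure \<nu> S"
  then show ?thesis
    using prob_space.prob_le_1[OF Pac_prob[OF assms(1)], of S] measure_nonneg[of \<nu> S] by linarith
qed simp

lemma kuiper_eq_1_iff: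
  assumes "\<mu> \<in> Pac" "\<nu> \<in> Pac"
  shows "kuiper \<mu> \<nu> = 1 \<longleftrightarrow> (\<exists>S\<in>arcs. measure \<mu> S = 1 \<and> measure \<nu> S = 0)"
proof
  assume *: "kuiper \<mu> \<nu> = 1"
  show "\<exists>S\<in>arcs. measure \<mu> S = 1 \<and> measure \<nu> S = 0"
  proof (rule kuiper_attained_arc[OF assms])
    fix S assume S: "S \<in> arcs" "kuiper \<mu> \<nu> = measure \<mu> S - measure \<nu> S"
    then have "measure \<mu> S = 1" "measure \<nu> S = 0"
      using * prob_space.prob_le_1[OF Pac_prob[OF assms(1)], of S] measure_nonneg[of \<nu> S] by linarith+
    with S show ?thesis by blast
  qed (use * in simp)
next
  assume "\<exists>S\<in>arcs. measure \<mu> S = 1 \<and> measure \<nu> S = 0"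
  then obtain S where "S \<in> arcs" "measure \<mu> S = 1" "measure \<nu> S = 0" by blast
  then have "1 \<le> kuiper \<mu> \<nu>" using kuiper_ge_arc[OF assms, of S] by simp
  with kuiper_le_1[OF assms] show "kuiper \<mu> \<nu> = 1" by simp
qed

section \<open>Complementary pairs and the action of an isometry on arcs\<close>

lemma Pac_mono: "\<mu> \<in> Pac \<Longrightarrow> A \<subseteq> B \<Longrightarrow> B \<in> sets borel \<Longrightarrow> measure \<mu> A \<le> measure \<mu> B"
  using prob_space.finite_measure[OF Pac_prob] by (auto simp: Pac_sets intro: finite_measure.finite_measure_mono)

lemma Pac_Un_disjoint:
  assumes "\<mu> \<in> Pac" "A \<in> sets borel" "B \<in> sets borel" "A \<inter> B = {}"
  shows "measure \<mu> (A \<union> B) = measure \<mu> A + measure \<mu> B"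
  using assms prob_space.finite_measure[OF Pac_prob[OF assms(1)]]
  by (intro finite_measure.finite_measure_Union) (auto simp: Pac_sets)

text \<open>Fullness of the topological support. This is weaker than having the null sets of
  Lebesgue measure on \<open>S\<close>, and it is the form that conditions on distances
  deliver.\<close>

definition full_on :: "real measure \<Rightarrow> real set \<Rightarrow> bool" where
  "full_on \<mu> S \<longleftrightarrow> (\<forall>a b. a < b \<and> {a<..b} \<subseteq> S \<longrightarrow> measure \<mu> {a<..b} \<noteq> 0)"

lemma full_on_gauss:
  assumes "S \<in> arcs"
  shows "full_on (gauss S) S"
  unfolding full_on_def using assms arcs_borel arcs_nonnull
  by (auto simp: gauss_eq_0_iff Int_absorb1)

text \<open>An arc \<open>T\<close> carrying \<mu> must contain \<open>S\<close>: a point of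
  \<open>S - T\<close> would be the right end of an interval inside \<open>S - T\<close>, which
  fullness charges although \<mu> vanishes off \<open>T\<close>. So separation by any arc forces
  \<nu> to miss \<open>S\<close>.\<close>

lemma full_on_kuiper_eq_1_iff:
  assumes "\<mu> \<in> Pac" "\<nu> \<in> Pac" "S \<in> arcs" "full_on \<mu> S" "measure \<mu> S = 1"
  shows "kuiper \<mu> \<nu> = 1 \<longleftrightarrow> measure \<nu> S = 0"
proof
  assume "kuiper \<mu> \<nu> = 1"
  then obtain T where T: "T \<in> arcs" "measure \<mu> T = 1" "measure \<nu> T = 0"
    using kuiper_eq_1_iff[OF assms(1,2)] by blast
  have "S \<subseteq> T"
  proof (rule ccontr)
    assume "\<not> S \<subseteq> T"
    then obtain x where x: "x \<in> S" "x \<in> - T" by blast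
    obtain y where y: "y < x" "{y<..x} \<subseteq> S"
      using arcs_left_subset[OF assms(3) x(1)] by blast
    obtain z where z: "z < x" "{z<..x} \<subseteq> - T"
      using arcs_left_subset[OF arcs_Compl[OF T(1)] x(2)] by blast
    have "measure \<mu> {max y z<..x} \<noteq> 0"
      using assms(4) y z unfolding full_on_def by (auto simp: subset_eq)
    moreover have "measure \<mu> {max y z<..x} \<le> measure \<mu> (- T)"
      using z arcs_borel[OF T(1)] by (intro Pac_mono[OF assms(1)]) auto
    moreover have "measure \<mu> (- T) = 0"
      using T arcs_borel[OF T(1)] by (simp add: Pac_Compl[OF assms(1)])
    ultimately show False using measure_nonneg[of \<mu> "{max y z<..x}"] by linarith
  qed
  then have "measure \<nu> S \<le> measure \<nu> T"
    using arcs_borel[OF T(1)] by (intro Pac_mono[OF assms(2)]) auto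
  then show "measure \<nu> S = 0" using T measure_nonneg[of \<nu> S] by linarith
next
  assume "measure \<nu> S = 0"
  then show "kuiper \<mu> \<nu> = 1" using kuiper_eq_1_iff[OF assms(1,2)] assms by blast
qed

definition supported :: "real set \<Rightarrow> real measure set" where
  "supported S = {\<mu> \<in> Pac. measure \<mu> S = 1}"

definition complementary :: "real measure \<Rightarrow> real measure \<Rightarrow> bool" where
  "complementary \<mu> \<nu> \<longleftrightarrow> kuiper \<mu> \<nu> = 1 \<and>
     (\<forall>\<mu>'\<in>Pac. \<forall>\<nu>'\<in>Pac. kuiper \<mu> \<nu>' = 1 \<and> kuiper \<mu>' \<nu> = 1 \<longrightarrow> kuiper \<mu>' \<nu>' = 1)"

text \<open>Being at distance 1 from a measure that is full on \<open>- S\<close> amounts to missing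
  \<open>- S\<close>. Thus one measure and the metric determine all of
  \<open>supported S\<close>.\<close>

lemma full_on_separating:
  assumes "\<mu> \<in> Pac" "S \<in> arcs" "full_on \<mu> (- S)" "measure \<mu> S = 0"
  shows "{\<nu> \<in> Pac. kuiper \<nu> \<mu> = 1} = supported S"
proof -
  have "measure \<mu> (- S) = 1" using assms by (simp add: Pac_Compl arcs_borel)
  then show ?thesis
    using full_on_kuiper_eq_1_iff[OF assms(1) _ arcs_Compl[OF assms(2)] assms(3)] assms
    by (auto simp: supported_def Pac_Compl arcs_borel kuiper_commute[of _ \<mu>])
qed

lemma complementary_gauss:
  assumes "S \<in> arcs"
  shows "complementary (gauss S) (gauss (- S))"
proof -
  note S = arcs_borel[OF assms] arcs_nonnull[OF assms]
  note S' = arcs_borel[OF arcs_Compl[OF assms]] arcs_nonnull[OF arcs_Compl[OF assms]]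
  have 1: "kuiper (gauss S) \<nu> = 1 \<longleftrightarrow> measure \<nu> S = 0" if "\<nu> \<in> Pac" for \<nu>
    using that S by (intro full_on_kuiper_eq_1_iff gauss_Pac assms full_on_gauss gauss_superset) auto
  have 2: "kuiper (gauss (- S)) \<nu> = 1 \<longleftrightarrow> measure \<nu> (- S) = 0" if "\<nu> \<in> Pac" for \<nu>
    using that S' by (intro full_on_kuiper_eq_1_iff gauss_Pac assms full_on_gauss gauss_superset arcs_Compl) auto
  show ?thesis
    unfolding complementary_def
  proof (intro conjI ballI impI)
    show "kuiper (gauss S) (gauss (- S)) = 1"
      using S S' by (subst 1) (auto intro: gauss_Pac gauss_disjoint)
    fix \<mu> \<nu> assume *: "\<mu> \<in> Pac" "\<nu> \<in> Pac" "kuiper (gauss S) \<nu> = 1 \<and> kuiper \<mu> (gauss (- S)) = 1"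
    then have "measure \<nu> S = 0" "measure \<mu> S = 1"
      using 1 2 S by (auto simp: kuiper_commute[of \<mu>] Pac_Compl)
    then show "kuiper \<mu> \<nu> = 1"
      using * assms kuiper_eq_1_iff by blast
  qed
qed

text \<open>A measure missing a subinterval of the second arc would leave room for two equal, hence
  not separated, measures.\<close>
lemma complementary_full_on:
  assumes "\<mu> \<in> Pac" "\<nu> \<in> Pac" "complementary \<mu> \<nu>" "S \<in> arcs" "measure \<mu> S = 1" "measure \<nu> S = 0"
  shows "full_on \<nu> (- S)"
  unfolding full_on_def
proof (intro allI impI notI)
  fix a b assume ab: "a < b \<and> {a<..b} \<subseteq> - S" and 0: "measure \<nu> {a<..b} = 0"
  let ?\<kappa> = "gauss {a<..b}"
  have \<kappa>: "?\<kappa> \<in> Pac" "measure ?\<kappa> S = 0" "measure ?\<kappa> {a<..b} = 1"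
    using ab arcs_borel[OF assms(4)] by (auto intro!: gauss_Pac gauss_disjoint gauss_superset)
  have "kuiper \<mu> ?\<kappa> = 1"
    using kuiper_eq_1_iff[OF assms(1) \<kappa>(1)] assms \<kappa> by blast
  moreover have "kuiper ?\<kappa> \<nu> = 1"
    using kuiper_eq_1_iff[OF \<kappa>(1) assms(2)] 0 \<kappa> ab arcs_intros(1) by blast
  ultimately have "kuiper ?\<kappa> ?\<kappa> = 1"
    using assms(3) \<kappa>(1) unfolding complementary_def by blast
  then show False by (simp add: kuiper_self)
qed

lemma complementary_arc:
  assumes "\<mu> \<in> Pac" "\<nu> \<in> Pac" "complementary \<mu> \<nu>"
  obtains S where "S \<in> arcs" "{\<mu>' \<in> Pac. kuiper \<mu>' \<nu> = 1} = supported S"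
proof -
  obtain S where S: "S \<in> arcs" "measure \<mu> S = 1" "measure \<nu> S = 0"
    using assms(3) kuiper_eq_1_iff[OF assms(1,2)] unfolding complementary_def by blast
  from full_on_separating[OF assms(2) S(1) complementary_full_on[OF assms S] S(3)] S(1)
  show thesis using that by blast
qed

lemma kuiper_supported_ge:
  assumes "\<mu> \<in> Pac" "\<nu> \<in> supported S" "S \<in> arcs"
  shows "1 - measure \<mu> S \<le> kuiper \<mu> \<nu>"
  using kuiper_ge_arc[of \<mu> \<nu> S] assms by (auto simp: supported_def)

text \<open>The closest measure supported by \<open>S\<close> is the conditional measure.\<close>
lemma kuiper_supported_le:
  assumes "\<mu> \<in> Pac" "S \<in> arcs"
  obtains \<nu> where "\<nu> \<in> supported S" "kuiper \<mu> \<nu> \<le> 1 - measure \<mu> S"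
proof (cases "measure \<mu> S = 0")
  case True
  \<comment> \<open>A null arc admits no conditional measure, but then the required bound is
    1.\<close>
  have "gauss S \<in> supported S"
    using assms arcs_borel arcs_nonnull by (auto simp: supported_def intro: gauss_Pac gauss_superset)
  with True that kuiper_le_1[OF assms(1)] show thesis by (auto simp: supported_def)
next
  case False
  interpret real_distribution \<mu> using assms(1) by (rule Pac_real_distribution)
  let ?\<nu> = "uniform_measure \<mu> S"
  let ?c = "measure \<mu> S"
  have c: "0 < ?c" "?c \<le> 1" using False by (auto simp: zero_less_measure_iff)
  have meas: "measure ?\<nu> K = measure \<mu> (S \<inter> K) / ?c" if "K \<in> sets borel" for K
    using False that assms arcs_borel by (intro measure_uniform_measure) (auto simp: emeasure_eq_measure)
  have \<nu>: "?\<nu> \<in> Pac"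
  proof (rule PacI)
    show "prob_space ?\<nu>"
      using False by (intro prob_space_uniform_measure) (auto simp: emeasure_eq_measure)
    show "sets ?\<nu> = sets borel" by simp
    fix N :: "real set" assume "N \<in> null_sets lborel"
    then have "N \<in> null_sets \<mu>" using assms(1) by (auto simp: Pac_def absolutely_continuous_def)
    moreover have "S \<in> sets \<mu>" using assms arcs_borel by simp
    ultimately have "emeasure \<mu> (S \<inter> N) = 0" by (blast intro: null_setsD1 null_set_Int1)
    then show "emeasure ?\<nu> N = 0"
      using \<open>N \<in> null_sets \<mu>\<close> \<open>S \<in> sets \<mu>\<close> by (subst emeasure_uniform_measure) auto
  qed
  moreover have "measure ?\<nu> S = 1" using meas[of S] arcs_borel[OF assms(2)] False by simp
  ultimately have "?\<nu> \<in> supported S" by (simp add: supported_def)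
  moreover have "kuiper \<mu> ?\<nu> \<le> 1 - ?c"
  proof (rule kuiper_attained_arc[OF assms(1) \<nu>])
    fix K assume K: "K \<in> arcs" "kuiper \<mu> ?\<nu> = measure \<mu> K - measure ?\<nu> K"
    have "measure \<mu> K = measure \<mu> (S \<inter> K) + measure \<mu> (K - S)"
      using K assms arcs_borel by (subst finite_measure_Union[symmetric]) (auto intro!: arg_cong[of _ _ "measure \<mu>"])
    moreover have "measure \<mu> (K - S) \<le> measure \<mu> (- S)"
      using assms arcs_borel by (intro Pac_mono) auto
    moreover have "measure \<mu> (- S) = 1 - ?c" using assms arcs_borel by (simp add: Pac_Compl)
    \<comment> \<open>Conditioning divides by \<open>?c \<le> 1\<close> and can only increase masses
      inside \<open>S\<close>, so the excess of \<mu> over \<open>?\<nu>\<close> on \<open>K\<close>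
      is at most the mass of \<open>K - S\<close>.\<close>
    moreover have "measure \<mu> (S \<inter> K) \<le> measure ?\<nu> K"
      using c arcs_borel[OF K(1)] by (simp add: meas pos_le_divide_eq mult_left_le)
    ultimately show ?thesis using K by linarith
  qed (use c in simp)
  ultimately show thesis by (rule that)
qed

section \<open>The image of an arc under an isometry\<close>

locale kuiper_isometry =
  fixes \<phi> :: "real measure \<Rightarrow> real measure"
  assumes surj: "\<phi> ` Pac = Pac"
    and isometry: "\<mu> \<in> Pac \<Longrightarrow> \<nu> \<in> Pac \<Longrightarrow> kuiper (\<phi> \<mu>) (\<phi> \<nu>) = kuiper \<mu> \<nu>"
begin

lemma phi_Pac: "\<mu> \<in> Pac \<Longrightarrow> \<phi> \<mu> \<in> Pac"
  using surj by blast

lemma phi_preimage: "\<nu> \<in> Pac \<Longrightarrow> \<exists>\<mu>\<in>Pac. \<nu> = \<phi> \<mu>"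
  using surj by blast

lemma phi_complementary:
  assumes "\<mu> \<in> Pac" "\<nu> \<in> Pac" "complementary \<mu> \<nu>"
  shows "complementary (\<phi> \<mu>) (\<phi> \<nu>)"
  unfolding complementary_def
proof (intro conjI ballI impI)
  show "kuiper (\<phi> \<mu>) (\<phi> \<nu>) = 1" using assms isometry by (simp add: complementary_def)
  fix m n assume *: "m \<in> Pac" "n \<in> Pac" "kuiper (\<phi> \<mu>) n = 1 \<and> kuiper m (\<phi> \<nu>) = 1"
  then obtain m' n' where "m' \<in> Pac" "m = \<phi> m'" "n' \<in> Pac" "n = \<phi> n'"
    using phi_preimage by metis
  with * assms show "kuiper m n = 1" by (auto simp: isometry complementary_def)
qed

text \<open>The measures carried by \<open>S\<close> are those at distance 1 from
  \<open>gauss (- S)\<close>. The image of that measure belongs to a complementary pair, so the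
  measures at distance 1 from the image are again all those carried by some arc.\<close>

lemma phi_supported:
  assumes "S \<in> arcs"
  obtains T where "T \<in> arcs" "\<phi> ` supported S = supported T"
proof -
  note S = arcs_borel[OF assms] arcs_nonnull[OF assms]
  note S' = arcs_borel[OF arcs_Compl[OF assms]] arcs_nonnull[OF arcs_Compl[OF assms]]
  have P: "gauss S \<in> Pac" "gauss (- S) \<in> Pac" using S S' by (auto intro: gauss_Pac)
  obtain T where T: "T \<in> arcs" "{\<mu> \<in> Pac. kuiper \<mu> (\<phi> (gauss (- S))) = 1} = supported T"
    using complementary_arc[OF _ _ phi_complementary[OF P complementary_gauss[OF assms]]] P phi_Pac
    by metis
  have "{\<mu> \<in> Pac. kuiper \<mu> (gauss (- S)) = 1} = supported S"
    using S S' full_on_gauss[OF arcs_Compl[OF assms]] assms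
    by (intro full_on_separating P) (auto intro: gauss_disjoint)
  then have "\<phi> ` supported S = \<phi> ` {\<mu> \<in> Pac. kuiper \<mu> (gauss (- S)) = 1}" by simp
  also have "\<dots> = {\<mu> \<in> Pac. kuiper \<mu> (\<phi> (gauss (- S))) = 1}"
  proof (intro equalityI subsetI)
    fix m assume "m \<in> {\<mu> \<in> Pac. kuiper \<mu> (\<phi> (gauss (- S))) = 1}"
    moreover from this obtain m' where "m' \<in> Pac" "m = \<phi> m'" using phi_preimage by blast
    ultimately show "m \<in> \<phi> ` {\<mu> \<in> Pac. kuiper \<mu> (gauss (- S)) = 1}"
      using isometry P by auto
  qed (use isometry P phi_Pac in auto)
  finally show thesis using that T by metis
qed

lemma phi_arc:
  assumes "S \<in> arcs"
  obtains T where "T \<in> arcs" "\<And>\<mu>. \<mu> \<in> Pac \<Longrightarrow> measure (\<phi> \<mu>) T = measure \<mu> S"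
proof -
  obtain T where T: "T \<in> arcs" "\<phi> ` supported S = supported T"
    using phi_supported[OF assms] by blast
  have "measure (\<phi> \<mu>) T = measure \<mu> S" if \<mu>: "\<mu> \<in> Pac" for \<mu>
  proof (rule antisym)
    obtain \<nu> where \<nu>: "\<nu> \<in> supported S" "kuiper \<mu> \<nu> \<le> 1 - measure \<mu> S"
      using kuiper_supported_le[OF \<mu> assms] by blast
    then have "1 - measure (\<phi> \<mu>) T \<le> kuiper (\<phi> \<mu>) (\<phi> \<nu>)"
      using T by (intro kuiper_supported_ge phi_Pac \<mu>) auto
    then show "measure \<mu> S \<le> measure (\<phi> \<mu>) T"
      using \<nu> \<mu> by (auto simp: isometry supported_def)
    obtain \<nu> where \<nu>: "\<nu> \<in> supported T" "kuiper (\<phi> \<mu>) \<nu> \<le> 1 - measure (\<phi> \<mu>) T"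
      using kuiper_supported_le[OF phi_Pac[OF \<mu>] T(1)] by blast
    obtain \<nu>' where \<nu>': "\<nu>' \<in> supported S" "\<nu> = \<phi> \<nu>'" using \<nu>(1) T(2) by blast
    have "1 - measure \<mu> S \<le> kuiper \<mu> \<nu>'"
      by (intro kuiper_supported_ge \<mu> \<nu>' assms)
    then show "measure (\<phi> \<mu>) T \<le> measure \<mu> S"
      using \<nu> \<nu>' \<mu> by (auto simp: isometry supported_def)
  qed
  then show thesis using that T(1) by blast
qed

end

section \<open>The common endpoint of the images of rays\<close>

text \<open>The identity is tested at a point \<open>x\<close> by \<open>gauss J\<close>, where
  \<open>J\<close> is a short interval ending at \<open>x\<close> on which all three arcs are
  constant: the mass of an arc is then its indicator at \<open>x\<close>. Hence the relation holds
  at every point, not just almost everywhere.\<close>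

lemma arcs_exact_additive:
  assumes "A \<in> arcs" "K \<in> arcs" "B \<in> arcs"
    and add: "\<And>\<nu>. \<nu> \<in> Pac \<Longrightarrow> measure \<nu> B = measure \<nu> A + measure \<nu> K"
  shows "A \<inter> K = {}" "B = A \<union> K"
proof -
  have *: "of_bool (x \<in> B) = of_bool (x \<in> A) + (of_bool (x \<in> K) :: real)" for x
  proof -
    obtain y1 y2 y3 where y: "y1 < x" "y2 < x" "y3 < x" "{y1<..x} \<subseteq> A \<or> {y1<..x} \<subseteq> - A"
      "{y2<..x} \<subseteq> B \<or> {y2<..x} \<subseteq> - B" "{y3<..x} \<subseteq> K \<or> {y3<..x} \<subseteq> - K"
      using arcs_left_constant assms(1-3) by meson
    define J where "J = {max y1 (max y2 y3)<..x}"
    have J: "J \<in> sets borel" "emeasure lborel J \<noteq> 0" "x \<in> J"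
      using y by (auto simp: J_def)
    have "measure (gauss J) S = of_bool (x \<in> S)" if "S \<in> arcs" "J \<subseteq> S \<or> J \<subseteq> - S" for S
      using that J arcs_borel[OF that(1)] by (auto intro!: gauss_superset gauss_disjoint)
    moreover have "J \<subseteq> A \<or> J \<subseteq> - A" "J \<subseteq> B \<or> J \<subseteq> - B" "J \<subseteq> K \<or> J \<subseteq> - K"
      using y unfolding J_def by auto
    ultimately show ?thesis
      using add[OF gauss_Pac[OF J(1,2)]] assms(1-3) by metis
  qed
  have "(x \<in> B \<longleftrightarrow> x \<in> A \<or> x \<in> K) \<and> \<not> (x \<in> A \<and> x \<in> K)" for x
    using *[of x] by (cases "x \<in> A"; cases "x \<in> B"; cases "x \<in> K") simp_all
  then show "A \<inter> K = {}" "B = A \<union> K" by blast+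
qed

text \<open>The boundary of an arc in the circle \<open>\<real> \<union> {\<infinity>}\<close>.\<close>
definition jumps :: "real set \<Rightarrow> real option set" where
  "jumps S = {p. case p of
      None \<Rightarrow> (\<forall>\<^sub>F y in at_top. y \<in> S) \<noteq> (\<forall>\<^sub>F y in at_bot. y \<in> S)
    | Some x \<Rightarrow> (x \<in> S) \<noteq> (\<forall>\<^sub>F y in at_right x. y \<in> S)}"

text \<open>For a general filter and set the two left-hand sides are not negations of each other.
  Here they are, because an interval is constant just right of \<open>x\<close> and
  \<open>at_right x\<close> is a proper filter.\<close>

lemma eventually_at_right_Ioc:
  "(\<forall>\<^sub>F y in at_right x. y \<in> {a<..b}) \<longleftrightarrow> a \<le> x \<and> x < (b::real)"
  "(\<forall>\<^sub>F y in at_right x. y \<notin> {a<..b}) \<longleftrightarrow> \<not> (a \<le> x \<and> x < (b::real))"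
proof -
  have 1: "a \<le> x \<and> x < b \<Longrightarrow> \<forall>\<^sub>F y in at_right x. y \<in> {a<..b}"
    by (auto simp: eventually_at_right_field intro!: exI[of _ b])
  have 2: "\<not> (a \<le> x \<and> x < b) \<Longrightarrow> \<forall>\<^sub>F y in at_right x. y \<notin> {a<..b}"
    by (auto simp: eventually_at_right_field not_le not_less intro: exI[of _ a] exI[of _ "x + 1"])
  have 3: "\<not> ((\<forall>\<^sub>F y in at_right x. y \<in> {a<..b}) \<and> (\<forall>\<^sub>F y in at_right x. y \<notin> {a<..b}))"
  proof
    assume "(\<forall>\<^sub>F y in at_right x. y \<in> {a<..b}) \<and> (\<forall>\<^sub>F y in at_right x. y \<notin> {a<..b})"
    then have "\<forall>\<^sub>F y in at_right x. False"
      unfolding eventually_conj_iff[symmetric] by (rule eventually_mono) auto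
    then show False by simp
  qed
  show "(\<forall>\<^sub>F y in at_right x. y \<in> {a<..b}) \<longleftrightarrow> a \<le> x \<and> x < b"
    "(\<forall>\<^sub>F y in at_right x. y \<notin> {a<..b}) \<longleftrightarrow> \<not> (a \<le> x \<and> x < b)"
    using 1 2 3 by blast+
qed

lemma eventually_at_right_Ioi:
  "(\<forall>\<^sub>F y in at_right x. a < y) \<longleftrightarrow> a \<le> (x::real)"
  "(\<forall>\<^sub>F y in at_right x. y \<le> a) \<longleftrightarrow> \<not> a \<le> (x::real)"
proof -
  have 1: "a \<le> x \<Longrightarrow> \<forall>\<^sub>F y in at_right x. a < y"
    by (auto simp: eventually_at_right_field intro!: exI[of _ "x + 1"])
  have 2: "\<not> a \<le> x \<Longrightarrow> \<forall>\<^sub>F y in at_right x. y \<le> a"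
    by (auto simp: eventually_at_right_field not_le intro: exI[of _ a])
  have 3: "\<not> ((\<forall>\<^sub>F y in at_right x. a < y) \<and> (\<forall>\<^sub>F y in at_right x. y \<le> a))"
  proof
    assume "(\<forall>\<^sub>F y in at_right x. a < y) \<and> (\<forall>\<^sub>F y in at_right x. y \<le> a)"
    then have "\<forall>\<^sub>F y in at_right x. False"
      unfolding eventually_conj_iff[symmetric] by (rule eventually_mono) auto
    then show False by simp
  qed
  show "(\<forall>\<^sub>F y in at_right x. a < y) \<longleftrightarrow> a \<le> x" "(\<forall>\<^sub>F y in at_right x. y \<le> a) \<longleftrightarrow> \<not> a \<le> x"
    using 1 2 3 by blast+
qed

lemma eventually_at_top_bot_Ioc:
  "\<not> (\<forall>\<^sub>F y in at_top. y \<le> (a::real))" "\<not> (\<forall>\<^sub>F y in at_top. b < y \<and> y \<le> (a::real))"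
  "\<not> (\<forall>\<^sub>F y in at_bot. a < (y::real))" "\<not> (\<forall>\<^sub>F y in at_bot. a < (y::real) \<and> y \<le> b)"
  "\<forall>\<^sub>F y in at_top. b < y \<longrightarrow> \<not> y \<le> (a::real)" "\<forall>\<^sub>F y in at_bot. b < y \<longrightarrow> \<not> y \<le> (a::real)"
proof -
  show top: "\<not> (\<forall>\<^sub>F y in at_top. y \<le> (a::real))" for a
    using eventually_conj[of "\<lambda>y. y \<le> a" at_top, OF _ eventually_gt_at_top[of a]]
    by (auto simp: not_le[symmetric])
  show bot: "\<not> (\<forall>\<^sub>F y in at_bot. a < (y::real))" for a
    using eventually_conj[of "\<lambda>y. a < y" at_bot, OF _ eventually_le_at_bot[of a]]
    by (auto simp: not_le[symmetric])
  show "\<not> (\<forall>\<^sub>F y in at_top. b < y \<and> y \<le> a)"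
    using top[of a] by (rule contrapos_nn) (auto elim: eventually_mono)
  show "\<not> (\<forall>\<^sub>F y in at_bot. a < y \<and> y \<le> b)"
    using bot[of a] by (rule contrapos_nn) (auto elim: eventually_mono)
  show "\<forall>\<^sub>F y in at_top. b < y \<longrightarrow> \<not> y \<le> a"
    using eventually_gt_at_top[of a] by eventually_elim auto
  show "\<forall>\<^sub>F y in at_bot. b < y \<longrightarrow> \<not> y \<le> a"
    using eventually_le_at_bot[of b] by eventually_elim auto
qed

lemma jumps_Ioc: "a < b \<Longrightarrow> jumps {a<..b} = {Some a, Some b}"
  unfolding jumps_def eventually_at_right_Ioc
  by (auto simp: eventually_at_top_bot_Ioc split: option.splits)

lemma jumps_Compl_Ioc: "a < b \<Longrightarrow> jumps (- {a<..b}) = {Some a, Some b}"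
  unfolding jumps_def Compl_iff eventually_at_right_Ioc
  by (auto simp: eventually_at_top_bot_Ioc split: option.splits)

lemma jumps_Ioi: "jumps {a<..} = {Some a, None}"
  unfolding jumps_def greaterThan_iff eventually_at_right_Ioi
  by (auto simp: eventually_at_top_bot_Ioc eventually_gt_at_top split: option.splits)

lemma jumps_Iic: "jumps {..a} = {Some a, None}"
  unfolding jumps_def atMost_iff eventually_at_right_Ioi
  by (auto simp: eventually_at_top_bot_Ioc eventually_le_at_bot split: option.splits)

lemma card_jumps: "S \<in> arcs \<Longrightarrow> card (jumps S) = 2"
  by (erule arcs_cases) (auto simp: jumps_Ioc jumps_Compl_Ioc jumps_Ioi jumps_Iic)

text \<open>The filters are the two germs at infinity and the right germ at each point; membership
  of a point stands in for its left germ. On arcs these filters behave like ultrafilters, which lets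
  \<open>eventually\<close> commute with unions.\<close>

lemma arcs_decided:
  assumes "S \<in> arcs" "F \<in> insert at_top (insert at_bot (range at_right))"
  shows "(\<forall>\<^sub>F y in F. y \<in> S) \<or> (\<forall>\<^sub>F y in F. y \<notin> S)"
proof -
  consider "F = at_top" | "F = at_bot" | x where "F = at_right x" using assms(2) by blast
  then show ?thesis
  proof cases
    case 1
    from assms(1) show ?thesis
      unfolding 1 by (cases rule: arcs_cases)
        (simp_all add: eventually_at_top_bot_Ioc eventually_gt_at_top eventually_gt_at_top[folded not_le])
  next
    case 2
    from assms(1) show ?thesis
      unfolding 2
      by (cases rule: arcs_cases)
        (simp_all add: eventually_at_top_bot_Ioc eventually_le_at_bot eventually_le_at_bot[folded not_less])
  next
    case (3 x)
    from assms(1) show ?thesis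
      unfolding 3
    proof (cases rule: arcs_cases)
      case (1 a b)
      then show "(\<forall>\<^sub>F y in at_right x. y \<in> S) \<or> (\<forall>\<^sub>F y in at_right x. y \<notin> S)"
        using eventually_at_right_Ioc[of a b x] by blast
    next
      case (2 a b)
      then show "(\<forall>\<^sub>F y in at_right x. y \<in> S) \<or> (\<forall>\<^sub>F y in at_right x. y \<notin> S)"
        using eventually_at_right_Ioc[of a b x] by (simp only: Compl_iff not_not) blast
    next
      case (3 a)
      then show "(\<forall>\<^sub>F y in at_right x. y \<in> S) \<or> (\<forall>\<^sub>F y in at_right x. y \<notin> S)"
        using eventually_at_right_Ioi[of a x] by (cases "a \<le> x") (simp_all add: not_less)
    next
      case (4 a)
      then show "(\<forall>\<^sub>F y in at_right x. y \<in> S) \<or> (\<forall>\<^sub>F y in at_right x. y \<notin> S)"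
        using eventually_at_right_Ioi[of a x] by (cases "a \<le> x") (simp_all add: not_le)
    qed
  qed
qed

text \<open>A jump is a change of germ, and in a disjoint union germs add modulo 2. Hence an
  endpoint common to both arcs disappears and every other endpoint survives.\<close>

lemma jumps_disjoint_Un:
  assumes "A \<in> arcs" "K \<in> arcs" "A \<inter> K = {}"
  shows "jumps (A \<union> K) = jumps A - jumps K \<union> (jumps K - jumps A)"
proof -
  have *: "(\<forall>\<^sub>F y in F. y \<in> A \<union> K) \<longleftrightarrow> (\<forall>\<^sub>F y in F. y \<in> A) \<or> (\<forall>\<^sub>F y in F. y \<in> K)"
    "\<not> ((\<forall>\<^sub>F y in F. y \<in> A) \<and> (\<forall>\<^sub>F y in F. y \<in> K))"
    if F: "F \<in> insert at_top (insert at_bot (range at_right))" for F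
  proof -
    have nt: "F \<noteq> bot" using F by (elim insertE rangeE) simp_all
    have "\<not> (\<forall>\<^sub>F y in F. y \<in> A \<union> K)" if "\<forall>\<^sub>F y in F. y \<notin> A" "\<forall>\<^sub>F y in F. y \<notin> K"
    proof
      assume "\<forall>\<^sub>F y in F. y \<in> A \<union> K"
      with that have "\<forall>\<^sub>F y in F. False" by eventually_elim auto
      with nt show False by (simp add: eventually_False)
    qed
    then show "(\<forall>\<^sub>F y in F. y \<in> A \<union> K) \<longleftrightarrow> (\<forall>\<^sub>F y in F. y \<in> A) \<or> (\<forall>\<^sub>F y in F. y \<in> K)"
      using arcs_decided[OF assms(1) F] arcs_decided[OF assms(2) F] by (auto elim: eventually_mono)
    show "\<not> ((\<forall>\<^sub>F y in F. y \<in> A) \<and> (\<forall>\<^sub>F y in F. y \<in> K))"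
    proof
      assume "(\<forall>\<^sub>F y in F. y \<in> A) \<and> (\<forall>\<^sub>F y in F. y \<in> K)"
      then have "\<forall>\<^sub>F y in F. False" using assms(3) by (auto elim: eventually_elim2)
      with nt show False by (simp add: eventually_False)
    qed
  qed
  have "p \<in> jumps (A \<union> K) \<longleftrightarrow> p \<in> jumps A - jumps K \<union> (jumps K - jumps A)" for p
  proof (cases p)
    case None
    then show ?thesis using *[of at_top] *[of at_bot] by (simp add: jumps_def) blast
  next
    case (Some x)
    then show ?thesis using *[of "at_right x"] assms(3) by (simp add: jumps_def) blast
  qed
  then show ?thesis by blast
qed

text \<open>If \<open>A\<close> and \<open>K\<close> share \<open>c\<close> endpoints, the symmetric
  difference has \<open>4 - 2c\<close> elements, and this must be 2. So one endpoint of
  \<open>A\<close> is absorbed and exactly one survives in the union.\<close>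

lemma card_jumps_Int:
  assumes "A \<in> arcs" "K \<in> arcs" "A \<union> K \<in> arcs" "A \<inter> K = {}"
  shows "card (jumps A \<inter> jumps (A \<union> K)) = 1"
proof -
  let ?A = "jumps A" and ?K = "jumps K"
  have fin: "finite ?A" "finite ?K"
    using card_jumps[OF assms(1)] card_jumps[OF assms(2)] by (auto intro: card_ge_0_finite)
  have "card (?A - ?K \<union> (?K - ?A)) = card (?A - ?K) + card (?K - ?A)"
    using fin by (intro card_Un_disjoint) auto
  moreover have "card (?A - ?K) = 2 - card (?A \<inter> ?K)" "card (?K - ?A) = 2 - card (?A \<inter> ?K)"
    using fin card_jumps assms by (auto simp: card_Diff_subset_Int Int_commute)
  ultimately have "card (?A - ?K) = 1"
    using card_jumps[OF assms(3)] jumps_disjoint_Un[OF assms(1,2,4)] by auto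
  moreover have "?A \<inter> jumps (A \<union> K) = ?A - ?K"
    using jumps_disjoint_Un[OF assms(1,2,4)] by blast
  ultimately show ?thesis by simp
qed

text \<open>Two-element sets that pairwise meet in one point have a common point, unless they are the
  three sides of a triangle.\<close>
lemma common_point:
  fixes E :: "real \<Rightarrow> 'a set"
  assumes two: "\<And>t. card (E t) = 2" and meet: "\<And>s t. s < t \<Longrightarrow> card (E s \<inter> E t) = 1"
  obtains p where "\<And>t. p \<in> E t"
proof -
  have meet': "\<exists>c. E s \<inter> E t = {c}" if "s \<noteq> t" for s t
    using meet[of s t] meet[of t s] that by (cases "s < t") (auto simp: Int_commute card_1_singleton_iff)
  obtain p where p: "E 0 \<inter> E 1 = {p}" using meet'[of 0 1] by auto
  have other: "\<exists>q. S = {p, q} \<and> q \<noteq> p" if S: "card S = 2" "p \<in> S" for S :: "'a set"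
  proof -
    obtain x y where "S = {x, y}" "x \<noteq> y" using S(1) unfolding card_2_iff by blast
    with S(2) show ?thesis by (cases "p = x") auto
  qed
  have "p \<in> E 0" "p \<in> E 1" using p by auto
  obtain q where q: "E 0 = {p, q}" "q \<noteq> p" using other[OF two \<open>p \<in> E 0\<close>] by blast
  obtain r where r: "E 1 = {p, r}" "r \<noteq> p" using other[OF two \<open>p \<in> E 1\<close>] by blast
  have qr: "q \<noteq> r" using p q r by auto
  have "p \<in> E t" for t
  proof (rule ccontr)
    assume pt: "p \<notin> E t"
    then have t: "t \<noteq> 0" "t \<noteq> 1" using q r by auto
    obtain c d where "E t \<inter> E 0 = {c}" "E t \<inter> E 1 = {d}"
      using meet'[OF t(1)] meet'[OF t(2)] by blast
    then have qrt: "q \<in> E t" "r \<in> E t" using pt q r by auto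
    obtain a b where "E t = {a, b}" using two[of t] unfolding card_2_iff by blast
    then have Et: "E t = {q, r}" using qrt qr by auto
    \<comment> \<open>A fourth set excludes the triangle with sides \<open>{p, q}\<close>,
      \<open>{p, r}\<close>, \<open>{q, r}\<close>: if it contains \<open>p\<close>, it avoids
      \<open>q\<close> and \<open>r\<close> and misses the third side; otherwise it contains
      \<open>q\<close> and \<open>r\<close> and meets that side twice.\<close>
    obtain u where u: "u \<notin> {0, 1, t}" using ex_new_if_finite[OF infinite_UNIV_char_0, of "{0, 1, t}"] by blast
    then have "u \<noteq> 0" "u \<noteq> 1" "u \<noteq> t" by auto
    from this[THEN meet'] obtain c d e
      where cde: "E u \<inter> E 0 = {c}" "E u \<inter> E 1 = {d}" "E u \<inter> E t = {e}" by blast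
    show False
    proof (cases "p \<in> E u")
      case True
      then have "q \<notin> E u" "r \<notin> E u" using cde q r by auto
      then show False using cde(3) Et by auto
    next
      case False
      then have "q \<in> E u" "r \<in> E u" using cde(1,2) q r by auto
      then show False using cde(3) Et qr by auto
    qed
  qed
  then show thesis by (rule that)
qed

section \<open>Moving an endpoint of an arc to infinity\<close>

lemma inj_r_map: "inj (r_map x)"
  by (auto simp: inj_def r_map_def split: option.splits)

lemma r_map_borel [measurable]: "r_map x \<in> borel_measurable borel"
  by (cases x) (simp_all add: r_map_def[abs_def])

text \<open>The finite set \<open>N\<close> absorbs the pole of \<open>r_map\<close>, where the
  value is 0, and endpoints, where open and closed rays differ. Which of the two rays occurs depends
  on the arc and on the endpoint sent to infinity.\<close>

definition ray_preimage :: "real option \<Rightarrow> real set \<Rightarrow> bool" where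
  "ray_preimage x S \<longleftrightarrow> (\<exists>h N. finite N \<and>
     ((\<forall>t. t \<notin> N \<longrightarrow> (t \<in> S \<longleftrightarrow> r_map x t \<le> h)) \<or> (\<forall>t. t \<notin> N \<longrightarrow> (t \<in> S \<longleftrightarrow> h \<le> r_map x t))))"

lemma ray_preimage_Compl:
  assumes "ray_preimage x S"
  shows "ray_preimage x (- S)"
proof -
  obtain h N where N: "finite N"
    "(\<forall>t. t \<notin> N \<longrightarrow> (t \<in> S \<longleftrightarrow> r_map x t \<le> h)) \<or> (\<forall>t. t \<notin> N \<longrightarrow> (t \<in> S \<longleftrightarrow> h \<le> r_map x t))"
    using assms unfolding ray_preimage_def by blast
  \<comment> \<open>Open and closed rays differ at the level \<open>h\<close> only, which the
    injective \<open>r_map x\<close> takes at most once.\<close>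
  have "finite (N \<union> r_map x -` {h})"
    using N(1) by (auto intro: finite_vimageI inj_r_map)
  moreover have "(\<forall>t. t \<notin> N \<union> r_map x -` {h} \<longrightarrow> (t \<in> - S \<longleftrightarrow> h \<le> r_map x t)) \<or>
    (\<forall>t. t \<notin> N \<union> r_map x -` {h} \<longrightarrow> (t \<in> - S \<longleftrightarrow> r_map x t \<le> h))"
    using N(2)
  proof
    assume *: "\<forall>t. t \<notin> N \<longrightarrow> (t \<in> S \<longleftrightarrow> r_map x t \<le> h)"
    show ?thesis by (rule disjI1) (use * in \<open>auto simp: less_le\<close>)
  next
    assume *: "\<forall>t. t \<notin> N \<longrightarrow> (t \<in> S \<longleftrightarrow> h \<le> r_map x t)"
    show ?thesis by (rule disjI2) (use * in \<open>auto simp: less_le\<close>)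
  qed
  ultimately show ?thesis unfolding ray_preimage_def by blast
qed

text \<open>In both cases the threshold is the image of the endpoint that is not sent to infinity.
  The pole \<open>b\<close> lies in the arc, but \<open>r_map (Some b) b = 0\<close> exceeds the
  negative threshold, so \<open>b\<close> is exceptional.\<close>

lemma ray_preimage_Ioc:
  assumes "a < b"
  shows "ray_preimage (Some a) {a<..b}" "ray_preimage (Some b) {a<..b}"
proof -
  have "t \<in> {a<..b} \<longleftrightarrow> 1 / (b - a) \<le> r_map (Some a) t" if "t \<notin> {a}" for t
    using assms that by (cases "a < t") (auto simp: r_map_def field_simps)
  then show "ray_preimage (Some a) {a<..b}"
    unfolding ray_preimage_def by (intro exI[of _ "1 / (b - a)"] exI[of _ "{a}"]) blast
  have "t \<in> {a<..b} \<longleftrightarrow> r_map (Some b) t \<le> 1 / (a - b)" if "t \<notin> {a, b}" for t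
    using assms that by (cases "t < b") (auto simp: r_map_def divide_simps)
  then show "ray_preimage (Some b) {a<..b}"
    unfolding ray_preimage_def by (intro exI[of _ "1 / (a - b)"] exI[of _ "{a, b}"]) blast
qed

lemma ray_preimage_Ioi: "ray_preimage (Some a) {a<..}" "ray_preimage None {a<..}"
proof -
  have "t \<in> {a<..} \<longleftrightarrow> 0 \<le> r_map (Some a) t" if "t \<notin> {a}" for t
    using that by (auto simp: r_map_def)
  then show "ray_preimage (Some a) {a<..}"
    unfolding ray_preimage_def by (intro exI[of _ 0] exI[of _ "{a}"]) blast
  have "t \<in> {a<..} \<longleftrightarrow> a \<le> r_map None t" if "t \<notin> {a}" for t
    using that by (auto simp: r_map_def)
  then show "ray_preimage None {a<..}"
    unfolding ray_preimage_def by (intro exI[of _ a] exI[of _ "{a}"]) blast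
qed

lemma ray_preimage_arc:
  assumes "S \<in> arcs" "x \<in> jumps S"
  shows "ray_preimage x S"
  using assms(1)
proof (cases rule: arcs_cases)
  case (4 a)
  then have "ray_preimage x (- {a<..})"
    using assms(2) by (intro ray_preimage_Compl) (auto simp: jumps_Iic ray_preimage_Ioi)
  with 4 show ?thesis by (simp add: Compl_greaterThan)
qed (use assms(2) in \<open>auto simp: jumps_Ioc jumps_Compl_Ioc jumps_Ioi ray_preimage_Ioc ray_preimage_Ioi
       intro: ray_preimage_Compl\<close>)

context kuiper_isometry
begin

text \<open>The common boundary point of the image arcs \<open>A t\<close> becomes \<open>x\<close>,
  and \<open>h t\<close> marks the other boundary point. Whether the ray points left or right may at
  this stage still depend on \<open>t\<close>.\<close>

lemma phi_rays:
  obtains x h where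
    "\<And>t. (\<forall>\<mu>\<in>Pac. measure (\<phi> \<mu>) {s. r_map x s \<le> h t} = measure \<mu> {..t}) \<or>
          (\<forall>\<mu>\<in>Pac. measure (\<phi> \<mu>) {s. h t \<le> r_map x s} = measure \<mu> {..t})"
proof -
  have "\<exists>A. A \<in> arcs \<and> (\<forall>\<mu>\<in>Pac. measure (\<phi> \<mu>) A = measure \<mu> {..t})" for t
    by (rule phi_arc[OF arcs_intros(4)[of t]]) blast
  then have "\<exists>A. \<forall>t. A t \<in> arcs \<and> (\<forall>\<mu>\<in>Pac. measure (\<phi> \<mu>) (A t) = measure \<mu> {..t})"
    by (intro choice allI)
  then obtain A where A: "\<And>t. A t \<in> arcs" "\<And>t \<mu>. \<mu> \<in> Pac \<Longrightarrow> measure (\<phi> \<mu>) (A t) = measure \<mu> {..t}"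
    by blast
  have "card (jumps (A s) \<inter> jumps (A t)) = 1" if st: "s < t" for s t
  proof -
    \<comment> \<open>The image \<open>K\<close> of \<open>{s<..t}\<close> is again an arc, and
      additivity for all measures forces \<open>A t\<close> to be the disjoint union of
      \<open>A s\<close> and \<open>K\<close>.\<close>
    obtain K where K: "K \<in> arcs" "\<And>\<mu>. \<mu> \<in> Pac \<Longrightarrow> measure (\<phi> \<mu>) K = measure \<mu> {s<..t}"
      using phi_arc[OF arcs_intros(1)[OF st]] by blast
    have add: "measure \<nu> (A t) = measure \<nu> (A s) + measure \<nu> K" if \<nu>: "\<nu> \<in> Pac" for \<nu>
    proof -
      obtain \<mu> where \<mu>: "\<mu> \<in> Pac" "\<nu> = \<phi> \<mu>" using phi_preimage[OF \<nu>] by blast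
      show ?thesis
        unfolding \<mu>(2) A(2)[OF \<mu>(1)] K(2)[OF \<mu>(1)] using Pac_Ioc[OF \<mu>(1), of s t] st by simp
    qed
    note ex = arcs_exact_additive[OF A(1) K(1) A(1), of t s, OF add]
    show ?thesis using card_jumps_Int[OF A(1)[of s] K(1)] ex A(1)[of t] by simp
  qed
  then obtain x where x: "\<And>t. x \<in> jumps (A t)"
    by (rule common_point[of "\<lambda>t. jumps (A t)", OF card_jumps[OF A(1)]]) blast+
  have "\<exists>h. (\<forall>\<mu>\<in>Pac. measure (\<phi> \<mu>) {s. r_map x s \<le> h} = measure \<mu> {..t}) \<or>
          (\<forall>\<mu>\<in>Pac. measure (\<phi> \<mu>) {s. h \<le> r_map x s} = measure \<mu> {..t})" for t
  proof -
    obtain h N where N: "finite N"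
      "(\<forall>s. s \<notin> N \<longrightarrow> (s \<in> A t \<longleftrightarrow> r_map x s \<le> h)) \<or> (\<forall>s. s \<notin> N \<longrightarrow> (s \<in> A t \<longleftrightarrow> h \<le> r_map x s))"
      using ray_preimage_arc[OF A(1) x] unfolding ray_preimage_def by blast
    have null: "N \<in> null_sets lborel" using N(1) by (simp add: finite_imp_null_set_lborel)
    show ?thesis
      using N(2)
    proof
      assume *: "\<forall>s. s \<notin> N \<longrightarrow> (s \<in> A t \<longleftrightarrow> r_map x s \<le> h)"
      have "measure (\<phi> \<mu>) {s. r_map x s \<le> h} = measure \<mu> {..t}" if "\<mu> \<in> Pac" for \<mu>
        unfolding A(2)[OF that, symmetric]
        by (rule measure_cong_off_null[OF phi_Pac[OF that] null])
          (use * arcs_borel[OF A(1)] in \<open>auto\<close>)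
      then show ?thesis by blast
    next
      assume *: "\<forall>s. s \<notin> N \<longrightarrow> (s \<in> A t \<longleftrightarrow> h \<le> r_map x s)"
      have "measure (\<phi> \<mu>) {s. h \<le> r_map x s} = measure \<mu> {..t}" if "\<mu> \<in> Pac" for \<mu>
        unfolding A(2)[OF that, symmetric]
        by (rule measure_cong_off_null[OF phi_Pac[OF that] null])
          (use * arcs_borel[OF A(1)] in \<open>auto\<close>)
      then show ?thesis by blast
    qed
  qed
  then have "\<exists>h. \<forall>t. (\<forall>\<mu>\<in>Pac. measure (\<phi> \<mu>) {s. r_map x s \<le> h t} = measure \<mu> {..t}) \<or>
          (\<forall>\<mu>\<in>Pac. measure (\<phi> \<mu>) {s. h t \<le> r_map x s} = measure \<mu> {..t})"
    by (intro choice allI)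
  then show thesis using that by blast
qed

end

section \<open>Transport by nonsingular maps\<close>

definition nonsingular :: "(real \<Rightarrow> real) \<Rightarrow> bool" where
  "nonsingular T \<longleftrightarrow> T \<in> borel_measurable borel \<and>
     (\<forall>N\<in>null_sets lborel. T -` N \<in> null_sets lborel)"

lemma nonsingular_measurable: "nonsingular T \<Longrightarrow> T \<in> borel_measurable borel"
  by (simp add: nonsingular_def)

lemma measure_distr_Pac:
  assumes "\<mu> \<in> Pac" "T \<in> borel_measurable borel" "B \<in> sets borel"
  shows "measure (distr \<mu> borel T) B = measure \<mu> (T -` B)"
    "emeasure (distr \<mu> borel T) B = emeasure \<mu> (T -` B)"
  using assms Pac_sets[OF assms(1)] Pac_space[OF assms(1)]
  by (simp_all add: measure_distr emeasure_distr measurable_cong_sets[of \<mu> borel])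

lemma distr_Pac:
  assumes "nonsingular T" "\<mu> \<in> Pac"
  shows "distr \<mu> borel T \<in> Pac"
proof (rule PacI)
  have m: "T \<in> measurable \<mu> borel"
    using assms Pac_sets[OF assms(2)] by (simp add: nonsingular_def measurable_cong_sets[of \<mu> borel])
  show "prob_space (distr \<mu> borel T)"
    using m by (rule prob_space.prob_space_distr[OF Pac_prob[OF assms(2)]])
  fix N :: "real set" assume N: "N \<in> null_sets lborel"
  then have "T -` N \<in> null_sets lborel" using assms by (simp add: nonsingular_def)
  then have "emeasure \<mu> (T -` N) = 0"
    using assms(2) by (auto simp: Pac_def absolutely_continuous_def null_sets_def)
  then show "emeasure (distr \<mu> borel T) N = 0"
    using N by (subst measure_distr_Pac(2)[OF assms(2) nonsingular_measurable[OF assms(1)]]) auto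
qed simp

lemma distr_distr_Pac:
  assumes "S \<in> borel_measurable borel" "T \<in> borel_measurable borel" "\<mu> \<in> Pac"
  shows "distr (distr \<mu> borel T) borel S = distr \<mu> borel (S \<circ> T)"
  using assms Pac_sets[OF assms(3)] by (intro distr_distr) (auto simp: measurable_cong_sets[of \<mu> borel])

lemma distr_id_Pac: "\<mu> \<in> Pac \<Longrightarrow> distr \<mu> borel (\<lambda>x. x) = \<mu>"
  using Pac_sets by (intro distr_id2) simp

lemma distr_inverse_Pac:
  assumes "S \<in> borel_measurable borel" "T \<in> borel_measurable borel" "\<mu> \<in> Pac" "\<And>x. S (T x) = x"
  shows "distr (distr \<mu> borel T) borel S = \<mu>"
  using distr_distr_Pac[OF assms(1-3)] distr_id_Pac[OF assms(3)] assms(4) by (simp add: comp_def)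

text \<open>A single test measure is enough to get back: \<open>gauss UNIV\<close> vanishes exactly
  on the Lebesgue null sets, so its push-forward tests every preimage.\<close>

lemma nonsingular_Pac_iff:
  assumes "T \<in> borel_measurable borel"
  shows "nonsingular T \<longleftrightarrow> (\<forall>\<mu>\<in>Pac. distr \<mu> borel T \<in> Pac)"
proof
  assume *: "\<forall>\<mu>\<in>Pac. distr \<mu> borel T \<in> Pac"
  have "T -` N \<in> null_sets lborel" if N: "N \<in> null_sets lborel" for N
  proof -
    have g: "gauss UNIV \<in> Pac" by (rule gauss_Pac) auto
    have TN: "T -` N \<in> sets borel" using measurable_sets[OF assms, of N] N by auto
    have "measure (gauss UNIV) (T -` N) = 0"
      using Pac_null[OF *[rule_format, OF g] N] N by (subst (asm) measure_distr_Pac[OF g assms]) auto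
    then have "emeasure lborel (T -` N) = 0"
      using gauss_eq_0_iff[OF _ _ TN, of UNIV] by simp
    with TN show ?thesis by auto
  qed
  with assms show "nonsingular T" by (simp add: nonsingular_def)
qed (use distr_Pac in blast)

lemma null_image_differentiable:
  fixes f :: "real \<Rightarrow> real"
  assumes "N \<in> null_sets lborel" "finite F" "f differentiable_on N - F" "f ` N \<in> sets borel"
  shows "f ` N \<in> null_sets lborel"
proof -
  have "negligible N"
    using assms(1) by (simp add: negligible_iff_null_sets null_sets_completionI)
  then have "negligible (N - F)" by (rule negligible_subset) auto
  then have "negligible (f ` (N - F))"
    using assms(3) by (intro negligible_differentiable_image_negligible) auto
  moreover have "negligible (f ` F)" using assms(2) by (intro negligible_finite) auto
  ultimately have "negligible (f ` (N - F) \<union> f ` F)" by (rule negligible_Un)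
  then have "negligible (f ` N)" by (rule negligible_subset) auto
  then have "emeasure lebesgue (f ` N) = 0" by (simp add: negligible_iff_null_sets null_sets_def)
  then have "emeasure lborel (f ` N) = 0" using assms(4) by simp
  with assms(4) show ?thesis by auto
qed

text \<open>Preimages under \<open>S\<close> are images under its inverse \<open>T\<close>, and
  differentiable maps carry null sets to null sets. The finite set \<open>F\<close> makes room for a
  pole.\<close>

lemma nonsingular_differentiable_inverse:
  assumes "S \<in> borel_measurable borel" "\<And>x. T (S x) = x" "\<And>x. S (T x) = x"
    and "finite F" "T differentiable_on - F"
  shows "nonsingular S"
  unfolding nonsingular_def
proof (intro conjI ballI assms(1))
  fix N :: "real set" assume N: "N \<in> null_sets lborel"
  have eq: "S -` N = T ` N"
  proof (intro equalityI subsetI)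
    fix x assume "x \<in> S -` N"
    then show "x \<in> T ` N" using assms(2)[of x] by (intro image_eqI[of _ _ "S x"]) auto
  qed (use assms(3) in auto)
  have "S -` N \<in> sets borel" using measurable_sets[OF assms(1), of N] N by auto
  then show "S -` N \<in> null_sets lborel"
    unfolding eq using N assms(4,5) by (intro null_image_differentiable[of _ F]) (auto intro: differentiable_on_subset)
qed

definition r_inv :: "real option \<Rightarrow> real \<Rightarrow> real" where
  "r_inv x s = (case x of None \<Rightarrow> s | Some y \<Rightarrow> y + 1 / s)"

text \<open>As \<open>1 / 0 = 0\<close>, the functions \<^const>\<open>r_map\<close> are total bijections of the line.\<close>
lemma r_inv_r_map: "r_inv x (r_map x t) = t" "r_map x (r_inv x t) = t"
  by (auto simp: r_inv_def r_map_def split: option.splits)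

lemma r_inv_borel [measurable]: "r_inv x \<in> borel_measurable borel"
  by (cases x) (simp_all add: r_inv_def[abs_def])

lemma nonsingular_r_map: "nonsingular (r_map x)" and nonsingular_r_inv: "nonsingular (r_inv x)"
proof -
  have "r_inv x differentiable_on - {0}"
    by (cases x) (auto simp: r_inv_def[abs_def] differentiable_on_def intro!: derivative_intros)
  then show "nonsingular (r_map x)"
    by (intro nonsingular_differentiable_inverse[of _ "r_inv x" "{0}"]) (auto simp: r_inv_r_map)
  have "r_map x differentiable_on - (case x of None \<Rightarrow> {} | Some y \<Rightarrow> {y})"
    by (cases x) (auto simp: r_map_def[abs_def] differentiable_on_def intro!: derivative_intros)
  then show "nonsingular (r_inv x)"
    by (intro nonsingular_differentiable_inverse[of _ "r_map x" "case x of None \<Rightarrow> {} | Some y \<Rightarrow> {y}"])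
      (auto simp: r_inv_r_map split: option.splits)
qed

lemma nonsingular_uminus: "nonsingular (\<lambda>x. - x)"
  by (rule nonsingular_differentiable_inverse[of _ "\<lambda>x. - x" "{}"]) (auto intro!: derivative_intros)

section \<open>Recovering a monotone map from its action on rays\<close>

lemma Pac_cdf_onto:
  assumes "\<mu> \<in> Pac" "0 < y" "y < 1"
  obtains t where "measure \<mu> {..t} = y"
proof -
  interpret real_distribution \<mu> using assms(1) by (rule Pac_real_distribution)
  interpret finite_borel_measure \<mu> by (rule finite_borel_measure_M)
  have "isCont (cdf \<mu>) t" for t using isCont_cdf Pac_singleton[OF assms(1)] by blast
  then have cont: "continuous_on S (cdf \<mu>)" for S by (auto intro: continuous_at_imp_continuous_on)
  obtain a where a: "\<And>t. t \<le> a \<Longrightarrow> cdf \<mu> t < y"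
    using order_tendstoD(2)[OF cdf_lim_at_bot assms(2)] by (auto simp: eventually_at_bot_linorder)
  obtain b where b: "\<And>t. t \<ge> b \<Longrightarrow> y < cdf \<mu> t"
    using order_tendstoD(1)[OF cdf_lim_at_top_prob assms(3)] by (auto simp: eventually_at_top_linorder)
  have "\<exists>t. min a b \<le> t \<and> t \<le> b \<and> cdf \<mu> t = y"
    using a[of "min a b"] b[of b] by (intro IVT' cont) auto
  then show thesis using that by (auto simp: cdf_def)
qed

lemma gauss_UNIV_cdf:
  shows "gauss UNIV \<in> Pac" "0 < measure (gauss UNIV) {..t}" "measure (gauss UNIV) {..t} < 1"
    "s < t \<Longrightarrow> measure (gauss UNIV) {..s} < measure (gauss UNIV) {..t}"
proof -
  show P: "gauss UNIV \<in> Pac" by (rule gauss_Pac) auto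
  have pos: "0 < measure (gauss UNIV) B" if "B \<in> sets borel" "emeasure lborel B \<noteq> 0" for B
    using gauss_eq_0_iff[of UNIV B] that by (auto simp: zero_less_measure_iff)
  show "0 < measure (gauss UNIV) {..t}" using pos[of "{..t}"] arcs_nonnull[OF arcs_intros(4)] by simp
  show "measure (gauss UNIV) {..t} < 1"
    using pos[of "{t<..}"] arcs_nonnull[OF arcs_intros(3)] by (simp add: Pac_Ioi[OF P])
  assume "s < t"
  then show "measure (gauss UNIV) {..s} < measure (gauss UNIV) {..t}"
    using pos[of "{s<..t}"] by (simp add: Pac_Ioc[OF P])
qed

text \<open>Monotonicity is tested on \<open>gauss {s<..t}\<close>, which has no mass up to
  \<open>s\<close> and full mass up to \<open>t\<close>. For surjectivity, a preimage of the normal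
  distribution has a continuous distribution function, which takes every value in (0, 1), while the
  normal one takes each value once. Then the rays \<open>{..h t}\<close> are all left rays and
  determine the measure.\<close>

lemma distr_of_left_rays:
  assumes onto: "\<psi> ` Pac = Pac"
    and ray: "\<And>t \<mu>. \<mu> \<in> Pac \<Longrightarrow> measure (\<psi> \<mu>) {..h t} = measure \<mu> {..t}"
  shows "strict_mono h" "surj h" "\<And>\<mu>. \<mu> \<in> Pac \<Longrightarrow> \<psi> \<mu> = distr \<mu> borel h"
proof -
  have \<psi>: "\<psi> \<mu> \<in> Pac" if "\<mu> \<in> Pac" for \<mu> using onto that by blast
  show mono: "strict_mono h"
  proof (rule strict_monoI, rule ccontr)
    fix s t assume st: "s < t" "\<not> h s < h t"
    let ?g = "gauss {s<..t}"
    have g: "?g \<in> Pac" using st by (intro gauss_Pac) auto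
    have "measure ?g {..t} = 1" "measure ?g {..s} = 0"
      using st by (auto intro!: gauss_superset gauss_disjoint)
    moreover have "measure (\<psi> ?g) {..h t} \<le> measure (\<psi> ?g) {..h s}"
      using st by (intro Pac_mono \<psi> g) auto
    ultimately show False using ray[OF g] by simp
  qed
  show surj: "surj h"
    unfolding surj_def
  proof
    fix y
    obtain \<mu> where \<mu>: "\<mu> \<in> Pac" "gauss UNIV = \<psi> \<mu>" using onto gauss_UNIV_cdf(1) by blast
    obtain t where "measure \<mu> {..t} = measure (gauss UNIV) {..y}"
      using Pac_cdf_onto[OF \<mu>(1) gauss_UNIV_cdf(2,3)] by blast
    then have "measure (gauss UNIV) {..h t} = measure (gauss UNIV) {..y}"
      using ray[OF \<mu>(1)] \<mu>(2) by simp
    then have "y = h t"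
      using gauss_UNIV_cdf(4)[of y "h t"] gauss_UNIV_cdf(4)[of "h t" y] by (cases y "h t" rule: linorder_cases) auto
    then show "\<exists>t. y = h t" ..
  qed
  have h: "h \<in> borel_measurable borel"
    using mono by (intro borel_measurable_mono strict_mono_mono)
  fix \<mu> assume \<mu>: "\<mu> \<in> Pac"
  show "\<psi> \<mu> = distr \<mu> borel h"
  proof (rule cdf_unique)
    show "real_distribution (\<psi> \<mu>)" using \<psi>[OF \<mu>] by (rule Pac_real_distribution)
    have "h \<in> measurable \<mu> borel" using h Pac_sets[OF \<mu>] by (simp add: measurable_cong_sets[of \<mu> borel])
    then show "real_distribution (distr \<mu> borel h)"
      by (rule prob_space.real_distribution_distr[OF Pac_prob[OF \<mu>]])
    show "cdf (\<psi> \<mu>) = cdf (distr \<mu> borel h)"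
    proof
      fix y obtain t where y: "y = h t" using surj by blast
      have "h -` {..y} = {..t}" using mono by (auto simp: y strict_mono_less_eq)
      then show "cdf (\<psi> \<mu>) y = cdf (distr \<mu> borel h) y"
        by (simp add: cdf_def measure_distr_Pac[OF \<mu> h] ray[OF \<mu>] flip: y)
          (simp add: y ray[OF \<mu>])
    qed
  qed
qed

lemma strict_mono_or_antimono_borel:
  fixes h :: "real \<Rightarrow> real"
  assumes "strict_mono h \<or> strict_antimono_on UNIV h"
  shows "h \<in> borel_measurable borel"
  using assms
proof
  assume "strict_antimono_on UNIV h"
  then have "mono (\<lambda>t. - h t)"
    unfolding strict_antimono_iff_antimono by (auto simp: monotone_on_def)
  then have "(\<lambda>t. - (- h t)) \<in> borel_measurable borel"
    by (intro borel_measurable_uminus borel_measurable_mono)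
  then show ?thesis by simp
qed (intro borel_measurable_mono strict_mono_mono)

lemma strict_mono_or_antimono_inv:
  fixes h :: "real \<Rightarrow> real"
  assumes "strict_mono h \<or> strict_antimono_on UNIV h" "bij h"
  shows "strict_mono (inv h) \<or> strict_antimono_on UNIV (inv h)"
  using assms(1)
proof
  assume "strict_mono h"
  then have "strict_mono (inv h)"
    using assms(2) by (intro strict_monoI) (metis bij_inv_eq_iff strict_mono_less)
  then show ?thesis ..
next
  assume anti: "strict_antimono_on UNIV h"
  have "inv h y < inv h x" if "x < y" for x y
  proof (rule ccontr)
    assume "\<not> inv h y < inv h x"
    then have "h (inv h y) \<le> h (inv h x)"
      using anti by (cases "inv h x = inv h y") (auto simp: monotone_on_def not_less le_less)
    with that assms(2) show False by (simp add: bij_is_surj surj_f_inv_f)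
  qed
  then show ?thesis by (auto simp: monotone_on_def)
qed

lemma distr_of_rays:
  assumes onto: "\<psi> ` Pac = Pac"
    and ray: "\<And>t. (\<forall>\<mu>\<in>Pac. measure (\<psi> \<mu>) {..h t} = measure \<mu> {..t}) \<or>
                   (\<forall>\<mu>\<in>Pac. measure (\<psi> \<mu>) {h t..} = measure \<mu> {..t})"
  shows "strict_mono h \<or> strict_antimono_on UNIV h" "bij h" "\<And>\<mu>. \<mu> \<in> Pac \<Longrightarrow> \<psi> \<mu> = distr \<mu> borel h"
proof -
  let ?L = "\<lambda>t. \<forall>\<mu>\<in>Pac. measure (\<psi> \<mu>) {..h t} = measure \<mu> {..t}"
  let ?R = "\<lambda>t. \<forall>\<mu>\<in>Pac. measure (\<psi> \<mu>) {h t..} = measure \<mu> {..t}"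
  have \<psi>: "\<psi> \<mu> \<in> Pac" if "\<mu> \<in> Pac" for \<mu> using onto that by blast
  \<comment> \<open>The test measure sits left of both \<open>h s\<close> and \<open>h t\<close>, or
    right of both, according to the order of \<open>s\<close> and \<open>t\<close>. One of the two
    rays then has mass 1 and the other 0, against the monotonicity of
    \<open>measure \<mu> {..t}\<close> in \<open>t\<close>.\<close>
  have separate: False if "a < b" "?L s" "?R t" "s \<le> t \<and> b \<le> h s \<and> b < h t \<or> t \<le> s \<and> h s \<le> a \<and> h t \<le> a" for s t a b
  proof -
    have g: "gauss {a<..b} \<in> Pac" using \<open>a < b\<close> by (intro gauss_Pac) auto
    then obtain \<mu> where \<mu>: "\<mu> \<in> Pac" "gauss {a<..b} = \<psi> \<mu>" using onto by blast
    have 1: "measure (gauss {a<..b}) {..h s} = measure \<mu> {..s}" "measure (gauss {a<..b}) {h t..} = measure \<mu> {..t}"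
      using that(2,3) \<mu> by auto
    from that(4) show False
    proof
      assume *: "s \<le> t \<and> b \<le> h s \<and> b < h t"
      then have "measure (gauss {a<..b}) {..h s} = 1" "measure (gauss {a<..b}) {h t..} = 0"
        using \<open>a < b\<close> by (auto intro!: gauss_superset gauss_disjoint)
      moreover have "measure \<mu> {..s} \<le> measure \<mu> {..t}" using * by (intro Pac_mono \<mu>) auto
      ultimately show False using 1 by simp
    next
      assume *: "t \<le> s \<and> h s \<le> a \<and> h t \<le> a"
      then have "measure (gauss {a<..b}) {h t..} = 1" "measure (gauss {a<..b}) {..h s} = 0"
        using \<open>a < b\<close> by (auto intro!: gauss_superset gauss_disjoint)
      moreover have "measure \<mu> {..t} \<le> measure \<mu> {..s}" using * by (intro Pac_mono \<mu>) auto
      ultimately show False using 1 by simp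
    qed
  qed
  have no_mix: False if "?L s" "?R t" for s t
  proof (cases "s \<le> t")
    case True
    have "min (h s) (h t) - 1 \<le> h s" "min (h s) (h t) - 1 < h t" by linarith+
    with True show False
      using separate[of "min (h s) (h t) - 2" "min (h s) (h t) - 1", OF _ that] by simp
  next
    case False
    then show False
      using separate[of "max (h s) (h t)" "max (h s) (h t) + 1", OF _ that] by simp
  qed
  consider "\<forall>t. ?L t" | "\<forall>t. ?R t" using ray no_mix by blast
  then have "(strict_mono h \<or> strict_antimono_on UNIV h) \<and> bij h \<and> (\<forall>\<mu>\<in>Pac. \<psi> \<mu> = distr \<mu> borel h)"
  proof cases
    case 1
    then have "strict_mono h" "surj h" "\<And>\<mu>. \<mu> \<in> Pac \<Longrightarrow> \<psi> \<mu> = distr \<mu> borel h"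
      using distr_of_left_rays[OF onto, of h] by auto
    then show ?thesis by (auto simp: bij_def intro: strict_mono_imp_inj_on)
  next
    case 2
    \<comment> \<open>A reflection turns right rays into left rays and reduces to the case already
      settled.\<close>
    let ?\<psi> = "\<lambda>\<mu>. distr (\<psi> \<mu>) borel (\<lambda>x. - x)"
    have flip: "distr (distr \<nu> borel (\<lambda>x. - x)) borel (\<lambda>x. - x) = \<nu>" if "\<nu> \<in> Pac" for \<nu> :: "real measure"
      using that by (intro distr_inverse_Pac) auto
    have onto': "?\<psi> ` Pac = Pac"
    proof (intro equalityI subsetI)
      fix \<nu> assume \<nu>: "\<nu> \<in> Pac"
      then obtain \<mu> where "\<mu> \<in> Pac" "distr \<nu> borel (\<lambda>x. - x) = \<psi> \<mu>"
        using onto distr_Pac[OF nonsingular_uminus] by blast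
      then show "\<nu> \<in> ?\<psi> ` Pac" using flip[OF \<nu>] by force
    qed (use \<psi> distr_Pac[OF nonsingular_uminus] in auto)
    have ray': "measure (?\<psi> \<mu>) {..- h t} = measure \<mu> {..t}" if "\<mu> \<in> Pac" for \<mu> t
    proof -
      have "(\<lambda>x. - x) -` {..- h t} = {h t..}" by auto
      then show ?thesis
        using 2 that by (simp add: measure_distr_Pac[OF \<psi>[OF that]])
    qed
    have *: "strict_mono (\<lambda>t. - h t)" "surj (\<lambda>t. - h t)"
      "\<And>\<mu>. \<mu> \<in> Pac \<Longrightarrow> ?\<psi> \<mu> = distr \<mu> borel (\<lambda>t. - h t)"
      using distr_of_left_rays[of ?\<psi> "\<lambda>t. - h t", OF onto' ray'] by blast+
    have anti: "strict_antimono_on UNIV h" using *(1) by (auto simp: monotone_on_def)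
    have h: "h \<in> borel_measurable borel" using anti strict_mono_or_antimono_borel by blast
    have "\<psi> \<mu> = distr \<mu> borel h" if \<mu>: "\<mu> \<in> Pac" for \<mu>
    proof -
      have "\<psi> \<mu> = distr (?\<psi> \<mu>) borel (\<lambda>x. - x)" using flip[OF \<psi>[OF \<mu>]] by simp
      also have "\<dots> = distr (distr \<mu> borel (\<lambda>t. - h t)) borel (\<lambda>x. - x)" using *(3)[OF \<mu>] by simp
      also have "\<dots> = distr \<mu> borel h"
        using h by (subst distr_distr_Pac[OF _ _ \<mu>]) (auto simp: comp_def)
      finally show ?thesis .
    qed
    moreover have "inj h" using *(1)[THEN strict_mono_imp_inj_on] by (auto simp: inj_on_def)
    moreover have "surj h" using *(2) unfolding surj_def by (metis minus_minus)
    ultimately show ?thesis using anti by (auto simp: bij_def)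
  qed
  then show "strict_mono h \<or> strict_antimono_on UNIV h" "bij h" "\<And>\<mu>. \<mu> \<in> Pac \<Longrightarrow> \<psi> \<mu> = distr \<mu> borel h"
    by auto
qed

text \<open>Composed with \<open>r_map x\<close>, the isometry acts on rays and is still onto
  \<open>Pac\<close>. This gives both nonsingularity claims: push-forwards by \<open>h\<close> lie
  in \<open>Pac\<close>, and every measure in \<open>Pac\<close> is such a push-forward, so
  \<open>inv h\<close> leads back into \<open>Pac\<close>.\<close>

lemma (in kuiper_isometry) phi_distr:
  obtains x h where "strict_mono h \<or> strict_antimono_on UNIV h" "bij h" "nonsingular h" "nonsingular (inv h)"
    "\<And>\<mu>. \<mu> \<in> Pac \<Longrightarrow> \<phi> \<mu> = distr \<mu> borel (r_inv x \<circ> h)"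
proof -
  obtain x h where xh: "\<And>t. (\<forall>\<mu>\<in>Pac. measure (\<phi> \<mu>) {s. r_map x s \<le> h t} = measure \<mu> {..t}) \<or>
          (\<forall>\<mu>\<in>Pac. measure (\<phi> \<mu>) {s. h t \<le> r_map x s} = measure \<mu> {..t})"
    using phi_rays by blast
  let ?\<psi> = "\<lambda>\<mu>. distr (\<phi> \<mu>) borel (r_map x)"
  have onto: "?\<psi> ` Pac = Pac"
  proof (intro equalityI subsetI)
    fix \<nu> assume \<nu>: "\<nu> \<in> Pac"
    then obtain \<mu> where "\<mu> \<in> Pac" "distr \<nu> borel (r_inv x) = \<phi> \<mu>"
      using phi_preimage[OF distr_Pac[OF nonsingular_r_inv]] by blast
    moreover have "distr (distr \<nu> borel (r_inv x)) borel (r_map x) = \<nu>"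
      using \<nu> by (intro distr_inverse_Pac) (auto simp: r_inv_r_map)
    ultimately show "\<nu> \<in> ?\<psi> ` Pac" by force
  qed (use phi_Pac distr_Pac[OF nonsingular_r_map] in auto)
  have "measure (?\<psi> \<mu>) {..h t} = measure (\<phi> \<mu>) {s. r_map x s \<le> h t}"
    "measure (?\<psi> \<mu>) {h t..} = measure (\<phi> \<mu>) {s. h t \<le> r_map x s}" if "\<mu> \<in> Pac" for \<mu> t
    using phi_Pac[OF that] by (simp_all add: measure_distr_Pac vimage_def)
  then have ray: "(\<forall>\<mu>\<in>Pac. measure (?\<psi> \<mu>) {..h t} = measure \<mu> {..t}) \<or>
                   (\<forall>\<mu>\<in>Pac. measure (?\<psi> \<mu>) {h t..} = measure \<mu> {..t})" for t
    using xh[of t] by auto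
  note h = distr_of_rays[of ?\<psi> h, OF onto ray]
  have hb: "h \<in> borel_measurable borel" using h(1) by (rule strict_mono_or_antimono_borel)
  have "strict_mono (inv h) \<or> strict_antimono_on UNIV (inv h)"
    using h(1,2) by (rule strict_mono_or_antimono_inv)
  then have hi: "inv h \<in> borel_measurable borel" by (rule strict_mono_or_antimono_borel)
  have "nonsingular h"
    unfolding nonsingular_Pac_iff[OF hb] using onto h(3) by auto
  moreover have "nonsingular (inv h)"
    unfolding nonsingular_Pac_iff[OF hi]
  proof
    fix \<nu> assume "\<nu> \<in> Pac"
    then obtain \<mu> where \<mu>: "\<mu> \<in> Pac" "\<nu> = distr \<mu> borel h" using onto h(3) by auto
    have "distr \<nu> borel (inv h) = \<mu>"
      unfolding \<mu>(2) using hb hi \<mu>(1) h(2) by (intro distr_inverse_Pac) (auto simp: bij_is_inj)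
    with \<mu>(1) show "distr \<nu> borel (inv h) \<in> Pac" by simp
  qed
  moreover have "\<phi> \<mu> = distr \<mu> borel (r_inv x \<circ> h)" if \<mu>: "\<mu> \<in> Pac" for \<mu>
  proof -
    have "\<phi> \<mu> = distr (?\<psi> \<mu>) borel (r_inv x)"
      by (rule distr_inverse_Pac[OF _ _ phi_Pac[OF \<mu>], symmetric]) (auto simp: r_inv_r_map)
    then show ?thesis using hb by (simp add: h(3)[OF \<mu>] distr_distr_Pac[OF _ _ \<mu>])
  qed
  ultimately show thesis using that h(1,2) by blast
qed

section \<open>Absolute continuity and nonsingularity\<close>

text \<open>Borel-Cantelli: if sets of length below \<open>(1/2)^k\<close> all had mass at least
  \<epsilon>, their limsup would have length 0 but, by continuity from above, mass at least
  \<epsilon>.\<close>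

lemma Pac_small_sets:
  assumes "M \<in> Pac" "\<epsilon> > 0"
  obtains \<delta> :: real where "\<delta> > 0"
    "\<And>B. B \<in> sets borel \<Longrightarrow> emeasure lborel B < ennreal \<delta> \<Longrightarrow> measure M B < \<epsilon>"
proof (rule ccontr)
  assume contr: "\<not> thesis"
  have "\<exists>B. B \<in> sets borel \<and> emeasure lborel B < ennreal ((1/2)^k) \<and> \<not> measure M B < \<epsilon>" for k :: nat
    using contr that[of "(1/2)^k"] by force
  then obtain B where B: "\<And>k::nat. B k \<in> sets borel" "\<And>k. emeasure lborel (B k) < ennreal ((1/2)^k)"
    "\<And>k. \<epsilon> \<le> measure M (B k)"
    unfolding not_less by metis
  have fin: "emeasure lborel (B k) < \<infinity>" for k
    using B(2)[of k] by (rule order.strict_trans) simp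
  have "measure lborel (B k) \<le> (1/2)^k" for k
    using B(2)[of k] fin[of k] by (simp add: emeasure_eq_ennreal_measure less_top ennreal_less_iff)
  then have "summable (\<lambda>k. measure lborel (B k))"
    by (intro summable_comparison_test'[OF summable_geometric[of "1/2"]]) auto
  then have "limsup B \<in> null_sets lborel"
    using B fin by (intro borel_cantelli_limsup1) auto
  then have null: "measure M (\<Inter>n. \<Union>m\<in>{n..}. B m) = 0"
    using Pac_null[OF assms(1)] by (simp add: limsup_INF_SUP)
  interpret real_distribution M using assms(1) by (rule Pac_real_distribution)
  have "(\<lambda>n. measure M (\<Union>m\<in>{n..}. B m)) \<longlonglongrightarrow> measure M (\<Inter>n. \<Union>m\<in>{n..}. B m)"
  proof (rule finite_Lim_measure_decseq)
    show "decseq (\<lambda>n. \<Union>m\<in>{n..}. B m)" by (force simp: decseq_def)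
  qed (use B(1) in auto)
  moreover have "\<epsilon> \<le> measure M (\<Union>m\<in>{n..}. B m)" for n
    using B(1) by (intro order_trans[OF B(3)[of n]] finite_measure_mono) auto
  ultimately have "\<epsilon> \<le> 0"
    unfolding null by (intro LIMSEQ_le_const) auto
  with assms(2) show False by simp
qed

lemma uniform_Icc_Pac:
  assumes "(u::real) < v"
  shows "uniform_measure lborel {u..v} \<in> Pac"
proof (rule PacI)
  show "prob_space (uniform_measure lborel {u..v})"
    using assms by (intro prob_space_uniform_measure) auto
  fix N :: "real set" assume N: "N \<in> null_sets lborel"
  then have "emeasure lborel ({u..v} \<inter> N) = 0" by (intro null_setsD1 null_set_Int1) auto
  then show "emeasure (uniform_measure lborel {u..v}) N = 0"
    using N by (subst emeasure_uniform_measure) auto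
qed simp

lemma abs_cont_onE:
  assumes "abs_cont_on f S" "\<epsilon> > 0"
  obtains \<delta> where "\<delta> > 0"
    "\<And>n c d. \<lbrakk>\<And>i. i < n \<Longrightarrow> c i \<le> d i; \<And>i. i < n \<Longrightarrow> {c i..d i} \<subseteq> S;
      \<And>i j. i < n \<Longrightarrow> j < n \<Longrightarrow> i \<noteq> j \<Longrightarrow> {c i<..<d i} \<inter> {c j<..<d j} = {}; (\<Sum>i<n. d i - c i) < \<delta>\<rbrakk>
      \<Longrightarrow> (\<Sum>i<(n::nat). \<bar>f (d i) - f (c i)\<bar>) < \<epsilon>"
proof -
  from assms obtain \<delta> where "\<delta> > 0" and *: "\<forall>(n::nat) c d. (\<forall>i<n. c i \<le> d i \<and> {c i..d i} \<subseteq> S) \<and>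
        (\<forall>i<n. \<forall>j<n. i \<noteq> j \<longrightarrow> {c i<..<d i} \<inter> {c j<..<d j} = {}) \<and> (\<Sum>i<n. d i - c i) < \<delta> \<longrightarrow>
        (\<Sum>i<n. \<bar>f (d i) - f (c i)\<bar>) < \<epsilon>"
    unfolding abs_cont_on_def by (elim allE[of _ \<epsilon>] impE exE conjE)
  then show thesis by (intro that[of \<delta>] *[rule_format] conjI allI impI) auto
qed

lemma abs_cont_on_subset:
  assumes "abs_cont_on f T" "S \<subseteq> T"
  shows "abs_cont_on f S"
  unfolding abs_cont_on_def
proof (intro allI impI)
  fix \<epsilon> :: real assume "0 < \<epsilon>"
  then obtain \<delta> where \<delta>: "\<delta> > 0"
    "\<And>n c d. \<lbrakk>\<And>i. i < n \<Longrightarrow> c i \<le> d i; \<And>i. i < n \<Longrightarrow> {c i..d i} \<subseteq> T;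
      \<And>i j. i < n \<Longrightarrow> j < n \<Longrightarrow> i \<noteq> j \<Longrightarrow> {c i<..<d i} \<inter> {c j<..<d j} = {}; (\<Sum>i<n. d i - c i) < \<delta>\<rbrakk>
      \<Longrightarrow> (\<Sum>i<(n::nat). \<bar>f (d i) - f (c i)\<bar>) < \<epsilon>"
    by (rule abs_cont_onE[OF assms(1)]) blast
  show "\<exists>\<delta>>0. \<forall>(n::nat) c d. (\<forall>i<n. c i \<le> d i \<and> {c i..d i} \<subseteq> S) \<and>
      (\<forall>i<n. \<forall>j<n. i \<noteq> j \<longrightarrow> {c i<..<d i} \<inter> {c j<..<d j} = {}) \<and> (\<Sum>i<n. d i - c i) < \<delta> \<longrightarrow>
      (\<Sum>i<n. \<bar>f (d i) - f (c i)\<bar>) < \<epsilon>"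
  proof (intro exI[of _ \<delta>] conjI \<delta>(1) allI impI)
    fix n :: nat and c d :: "nat \<Rightarrow> real"
    assume *: "(\<forall>i<n. c i \<le> d i \<and> {c i..d i} \<subseteq> S) \<and>
      (\<forall>i<n. \<forall>j<n. i \<noteq> j \<longrightarrow> {c i<..<d i} \<inter> {c j<..<d j} = {}) \<and> (\<Sum>i<n. d i - c i) < \<delta>"
    then have "\<And>i. i < n \<Longrightarrow> {c i..d i} \<subseteq> T" using assms(2) by blast
    with * show "(\<Sum>i<n. \<bar>f (d i) - f (c i)\<bar>) < \<epsilon>" by (intro \<delta>(2)) blast+
  qed
qed

lemma vimage_monotone_Ioo:
  fixes h :: "real \<Rightarrow> real"
  assumes "strict_mono h \<or> strict_antimono_on UNIV h" "bij h" "u \<le> v"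
  shows "h -` {u<..<v} = {min (inv h u) (inv h v)<..<max (inv h u) (inv h v)}"
    "inv h ` {u..v} \<subseteq> {min (inv h u) (inv h v)..max (inv h u) (inv h v)}"
proof -
  obtain u' v' where uv: "u = h u'" "v = h v'" using bij_is_surj[OF assms(2)] by (metis surjD)
  have inv: "inv h (h x) = x" for x using assms(2) by (simp add: bij_is_inj)
  from assms(1) have "h -` {u<..<v} = {min u' v'<..<max u' v'} \<and> h -` {u..v} \<subseteq> {min u' v'..max u' v'}"
  proof
    assume "strict_mono h"
    then show ?thesis using assms(3) by (auto simp: uv strict_mono_less strict_mono_less_eq)
  next
    assume anti: "strict_antimono_on UNIV h"
    then have less: "h x < h y \<longleftrightarrow> y < x" for x y
      by (cases x y rule: linorder_cases) (auto simp: monotone_on_def dest: less_asym)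
    have le: "h x \<le> h y \<longleftrightarrow> y \<le> x" for x y using less by (metis not_le)
    show ?thesis using assms(3) by (auto simp: uv less le)
  qed
  moreover have "inv h ` {u..v} = h -` {u..v}" using assms(2) by (simp add: bij_vimage_eq_inv_image)
  ultimately show "h -` {u<..<v} = {min (inv h u) (inv h v)<..<max (inv h u) (inv h v)}"
    "inv h ` {u..v} \<subseteq> {min (inv h u) (inv h v)..max (inv h u) (inv h v)}"
    by (simp_all add: uv inv)
qed

text \<open>Pushing a uniform measure forward by \<open>h\<close> gives a measure \<open>M\<close>
  for which the increments of \<open>inv h\<close> are, up to the factor \<open>v - u\<close>,
  masses of intervals. The epsilon-delta form of absolute continuity of \<open>M\<close> is then
  that of \<open>inv h\<close>.\<close>

lemma nonsingular_imp_abs_cont_inv: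
  assumes "strict_mono h \<or> strict_antimono_on UNIV h" "bij h" "nonsingular h"
  shows "abs_cont_on (inv h) {a..b}"
proof -
  let ?g = "inv h"
  \<comment> \<open>The enlarged interval is nondegenerate whatever \<open>a\<close> and
    \<open>b\<close> are, as the uniform measure on \<open>{u..v}\<close> requires.\<close>
  define b' where "b' = max a b + 1"
  have ab: "a < b'" "{a..b} \<subseteq> {a..b'}" by (auto simp: b'_def)
  define u where "u = min (?g a) (?g b')"
  define v where "v = max (?g a) (?g b')"
  have "?g a \<noteq> ?g b'" using ab(1) assms(2) by (metis bij_inv_eq_iff less_irrefl)
  then have uv: "u < v" by (auto simp: u_def v_def)
  define M where "M = distr (uniform_measure lborel {u..v}) borel h"
  have M: "M \<in> Pac" unfolding M_def by (intro distr_Pac assms uniform_Icc_Pac uv)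
  have range: "?g x \<in> {u..v}" if "x \<in> {a..b'}" for x
    unfolding u_def v_def
    by (rule subsetD[OF vimage_monotone_Ioo(2)[OF assms(1,2) less_imp_le[OF ab(1)]] imageI[OF that]])
  have meas: "measure M {c<..<d} = \<bar>?g d - ?g c\<bar> / (v - u)" if "c \<le> d" "{c..d} \<subseteq> {a..b'}" for c d
  proof -
    have "?g c \<in> {u..v}" "?g d \<in> {u..v}" using that range by auto
    then have sub: "{u..v} \<inter> {min (?g c) (?g d)<..<max (?g c) (?g d)} = {min (?g c) (?g d)<..<max (?g c) (?g d)}"
      by auto
    have "measure M {c<..<d} = measure (uniform_measure lborel {u..v}) (h -` {c<..<d})"
      unfolding M_def by (intro measure_distr_Pac uniform_Icc_Pac uv nonsingular_measurable assms) simp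
    also have "\<dots> = measure lborel {min (?g c) (?g d)<..<max (?g c) (?g d)} / measure lborel {u..v}"
      using uv unfolding vimage_monotone_Ioo(1)[OF assms(1,2) that(1)]
      by (subst measure_uniform_measure) (auto simp: sub)
    finally show ?thesis using uv by (auto simp: min_def max_def)
  qed
  have "abs_cont_on ?g {a..b'}"
    unfolding abs_cont_on_def
  proof (intro allI impI)
    fix \<epsilon> :: real assume "0 < \<epsilon>"
    with uv have "0 < \<epsilon> / (v - u)" by simp
    then obtain \<delta> where \<delta>: "\<delta> > 0"
      "\<And>B. B \<in> sets borel \<Longrightarrow> emeasure lborel B < ennreal \<delta> \<Longrightarrow> measure M B < \<epsilon> / (v - u)"
      using Pac_small_sets[OF M] by blast
    show "\<exists>\<delta>>0. \<forall>(n::nat) c d. (\<forall>i<n. c i \<le> d i \<and> {c i..d i} \<subseteq> {a..b'}) \<and>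
        (\<forall>i<n. \<forall>j<n. i \<noteq> j \<longrightarrow> {c i<..<d i} \<inter> {c j<..<d j} = {}) \<and> (\<Sum>i<n. d i - c i) < \<delta> \<longrightarrow>
        (\<Sum>i<n. \<bar>?g (d i) - ?g (c i)\<bar>) < \<epsilon>"
    proof (intro exI[of _ \<delta>] conjI \<delta>(1) allI impI)
      fix n :: nat and c d :: "nat \<Rightarrow> real"
      assume *: "(\<forall>i<n. c i \<le> d i \<and> {c i..d i} \<subseteq> {a..b'}) \<and>
        (\<forall>i<n. \<forall>j<n. i \<noteq> j \<longrightarrow> {c i<..<d i} \<inter> {c j<..<d j} = {}) \<and> (\<Sum>i<n. d i - c i) < \<delta>"
      let ?U = "\<Union>i<n. {c i<..<d i}"
      have "emeasure lborel ?U \<le> (\<Sum>i<n. emeasure lborel {c i<..<d i})"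
        by (intro emeasure_subadditive_finite) auto
      also have "\<dots> = ennreal (\<Sum>i<n. d i - c i)"
        using * by (subst sum_ennreal[symmetric]) (auto intro!: sum.cong)
      also have "\<dots> < ennreal \<delta>" using * \<delta>(1) by (intro ennreal_lessI) auto
      finally have "measure M ?U < \<epsilon> / (v - u)" by (intro \<delta>(2)) auto
      moreover have "measure M ?U = (\<Sum>i<n. measure M {c i<..<d i})"
      proof (rule finite_measure.finite_measure_finite_Union[OF prob_space.finite_measure[OF Pac_prob[OF M]]])
        show "disjoint_family_on (\<lambda>i. {c i<..<d i}) {..<n}"
          unfolding disjoint_family_on_def using * by blast
      qed (auto simp: Pac_sets[OF M])
      moreover have "\<dots> = (\<Sum>i<n. \<bar>?g (d i) - ?g (c i)\<bar>) / (v - u)"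
        using * by (simp add: meas sum_divide_distrib)
      ultimately show "(\<Sum>i<n. \<bar>?g (d i) - ?g (c i)\<bar>) < \<epsilon>"
        using uv by (simp add: divide_less_cancel)
    qed
  qed
  then show ?thesis using ab(2) by (rule abs_cont_on_subset)
qed

section \<open>Absolute continuity and Luzin's condition (N)\<close>

lemma abs_cont_on_imp_isCont:
  assumes "\<And>a b. abs_cont_on g {a..b}"
  shows "isCont g x"
  unfolding continuous_at_eps_delta
proof (intro allI impI)
  fix \<epsilon> :: real assume "0 < \<epsilon>"
  note acE = abs_cont_onE[OF assms[of "x - 1" "x + 1"] this]
  obtain \<delta> where \<delta>: "\<delta> > 0"
    "\<And>n c d. \<lbrakk>\<And>i. i < n \<Longrightarrow> c i \<le> d i; \<And>i. i < n \<Longrightarrow> {c i..d i} \<subseteq> {x - 1..x + 1};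
      \<And>i j. i < n \<Longrightarrow> j < n \<Longrightarrow> i \<noteq> j \<Longrightarrow> {c i<..<d i} \<inter> {c j<..<d j} = {}; (\<Sum>i<n. d i - c i) < \<delta>\<rbrakk>
      \<Longrightarrow> (\<Sum>i<(n::nat). \<bar>g (d i) - g (c i)\<bar>) < \<epsilon>"
    by (rule acE) blast
  have "dist (g y) (g x) < \<epsilon>" if "dist y x < min \<delta> 1" for y
    using \<delta>(2)[of "Suc 0" "\<lambda>_. min x y" "\<lambda>_. max x y"] that
    by (auto simp: dist_real_def min_def max_def abs_if split: if_splits)
  then show "\<exists>d>0. \<forall>y. dist y x < d \<longrightarrow> dist (g y) (g x) < \<epsilon>"
    using \<delta>(1) by (intro exI[of _ "min \<delta> 1"]) auto
qed

text \<open>A null set is covered by nonoverlapping intervals of small total length, and absolute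
  continuity makes the total length of their images small; by monotonicity the image of an interval
  lies between the images of its ends.\<close>

lemma abs_cont_on_null_image:
  assumes mono: "strict_mono g \<or> strict_antimono_on UNIV g" and ac: "abs_cont_on g {a..b}"
    and "a < b" "S \<subseteq> {a..b}" "S \<in> null_sets lborel" "g ` S \<in> sets borel"
  shows "g ` S \<in> null_sets lborel"
proof -
  have le_eps: "emeasure lborel (g ` S) \<le> 0 + ennreal \<epsilon>" if \<epsilon>: "0 < \<epsilon>" for \<epsilon>
  proof -
    obtain \<delta> where \<delta>: "\<delta> > 0"
      "\<And>n c d. \<lbrakk>\<And>i. i < n \<Longrightarrow> c i \<le> d i; \<And>i. i < n \<Longrightarrow> {c i..d i} \<subseteq> {a..b};
        \<And>i j. i < n \<Longrightarrow> j < n \<Longrightarrow> i \<noteq> j \<Longrightarrow> {c i<..<d i} \<inter> {c j<..<d j} = {}; (\<Sum>i<n. d i - c i) < \<delta>\<rbrakk>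
        \<Longrightarrow> (\<Sum>i<(n::nat). \<bar>g (d i) - g (c i)\<bar>) < \<epsilon>"
      by (rule abs_cont_onE[OF ac \<epsilon>]) blast
    have S: "S \<in> sets borel" "S \<in> sets lebesgue" "emeasure lborel S = 0" using assms(5) by auto
    obtain U where U: "open U" "S \<subseteq> U" "emeasure lebesgue (U - S) < ennreal \<delta>"
      by (rule sets_lebesgue_outer_open[OF S(2) \<delta>(1)]) blast
    have "emeasure lborel U \<le> emeasure lborel ((U - S) \<union> S)"
      using U S by (intro emeasure_mono) auto
    also have "\<dots> \<le> emeasure lborel (U - S) + emeasure lborel S"
      using U S by (intro emeasure_subadditive) auto
    also have "\<dots> < ennreal \<delta>" using U S by simp
    finally have U': "emeasure lborel U < ennreal \<delta>" .
    \<comment> \<open>A gauge equal to \<open>U\<close> at the points of \<open>S\<close> forces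
      every interval of the covering, being tagged in \<open>S\<close>, to lie inside
      \<open>U\<close>. Disjoint interiors then bound the total length by that of
      \<open>U\<close>.\<close>
    have gauge: "gauge (\<lambda>x. if x \<in> U then U else UNIV)" using U(1) by (auto simp: gauge_def)
    have "S \<subseteq> cbox a b" "box a b \<noteq> {}" using assms by auto
    from covering_lemma[OF this gauge] obtain \<D> where \<D>: "countable \<D>" "\<Union>\<D> \<subseteq> cbox a b"
      "\<And>K. K \<in> \<D> \<Longrightarrow> interior K \<noteq> {} \<and> (\<exists>c d. K = cbox c d)"
      "pairwise (\<lambda>A B. interior A \<inter> interior B = {}) \<D>"
      "\<And>K. K \<in> \<D> \<Longrightarrow> \<exists>x \<in> S \<inter> K. K \<subseteq> (if x \<in> U then U else UNIV)" "S \<subseteq> \<Union>\<D>"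
      by metis
    define l where "l K = Inf K" for K :: "real set"
    define r where "r K = Sup K" for K :: "real set"
    have lr: "l K < r K" "{l K..r K} = K" if K: "K \<in> \<D>" for K
    proof -
      obtain c d where "K = cbox c d" "interior K \<noteq> {}" using \<D>(3)[OF K] by blast
      then have "{c<..<d} \<noteq> {}" "K = {c..d}" by (simp_all add: interior_cbox)
      then show "l K < r K" "{l K..r K} = K" by (simp_all add: l_def r_def)
    qed
    have sub: "K \<subseteq> U" "K \<subseteq> {a..b}" if K: "K \<in> \<D>" for K
    proof -
      obtain x where "x \<in> S" "K \<subseteq> (if x \<in> U then U else UNIV)" using \<D>(5)[OF K] by blast
      then show "K \<subseteq> U" using U(2) by (simp add: subsetD)
      show "K \<subseteq> {a..b}" using \<D>(2) K by auto
    qed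
    define T where "T K = {min (g (l K)) (g (r K))..max (g (l K)) (g (r K))}" for K
    have emT: "emeasure lborel (T K) = ennreal \<bar>g (r K) - g (l K)\<bar>" for K
      by (cases "g (l K) \<le> g (r K)") (simp_all add: T_def)
    have T: "g ` K \<subseteq> T K" if "K \<in> \<D>" for K
    proof -
      have "g x \<in> T K" if x: "l K \<le> x" "x \<le> r K" for x
        using mono
      proof
        assume "strict_mono g"
        then have "g (l K) \<le> g x" "g x \<le> g (r K)" using x by (simp_all add: strict_mono_less_eq)
        then show ?thesis by (auto simp: T_def)
      next
        assume "strict_antimono_on UNIV g"
        then have "g (r K) \<le> g x" "g x \<le> g (l K)"
          using x by (auto simp: monotone_on_def le_less)
        then show ?thesis by (auto simp: T_def)
      qed
      then have "g ` {l K..r K} \<subseteq> T K" by auto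
      then show ?thesis by (simp only: lr(2)[OF that])
    qed
    \<comment> \<open>\<open>abs_cont_on\<close> speaks of finite families only, so a uniform bound
      for finite subfamilies is proved; continuity from below carries it to the countable
      covering.\<close>
    have fin: "emeasure lborel (\<Union>K\<in>F. T K) \<le> ennreal \<epsilon>" if F: "finite F" "F \<subseteq> \<D>" for F
    proof -
      obtain e where e: "bij_betw e {..<card F} F"
        using ex_bij_betw_nat_finite[OF F(1)] by (auto simp: atLeast0LessThan)
      have e\<D>: "e i \<in> \<D>" if "i < card F" for i using e that F(2) by (auto simp: bij_betw_def)
      have disj: "{l (e i)<..<r (e i)} \<inter> {l (e j)<..<r (e j)} = {}"
        if "i < card F" "j < card F" "i \<noteq> j" for i j
      proof -
        have "e i \<noteq> e j" using e that by (auto simp: bij_betw_def inj_on_def)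
        then have "interior (e i) \<inter> interior (e j) = {}" using \<D>(4) e\<D> that by (auto simp: pairwise_def)
        moreover have "interior (e k) = {l (e k)<..<r (e k)}" if "k < card F" for k
          using interior_atLeastAtMost_real[of "l (e k)" "r (e k)"] by (simp only: lr(2)[OF e\<D>[OF that]])
        ultimately show ?thesis using that by simp
      qed
      have "ennreal (\<Sum>i<card F. r (e i) - l (e i)) = (\<Sum>i<card F. emeasure lborel {l (e i)<..<r (e i)})"
        using lr(1)[OF e\<D>] by (subst sum_ennreal[symmetric]) (auto intro!: sum.cong simp: less_imp_le)
      also have "\<dots> = emeasure lborel (\<Union>i<card F. {l (e i)<..<r (e i)})"
        using disj by (intro sum_emeasure) (auto simp: disjoint_family_on_def)
      also have "\<dots> \<le> emeasure lborel U"
      proof (intro emeasure_mono UN_least)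
        fix i assume "i \<in> {..<card F}"
        then have "{l (e i)..r (e i)} \<subseteq> U" using sub(1)[OF e\<D>] by (simp add: lr(2)[OF e\<D>])
        then show "{l (e i)<..<r (e i)} \<subseteq> U" by force
      qed (use U in auto)
      also note U'
      finally have sum: "(\<Sum>i<card F. r (e i) - l (e i)) < \<delta>"
        by (meson ennreal_leI not_le)
      have cond: "\<forall>i<card F. l (e i) \<le> r (e i) \<and> {l (e i)..r (e i)} \<subseteq> {a..b}"
        using lr(1)[OF e\<D>] sub(2)[OF e\<D>] by (simp add: lr(2)[OF e\<D>] less_imp_le)
      have "emeasure lborel (\<Union>K\<in>F. T K) \<le> (\<Sum>K\<in>F. emeasure lborel (T K))"
        using F by (intro emeasure_subadditive_finite) (auto simp: T_def)
      also have "\<dots> = (\<Sum>i<card F. emeasure lborel (T (e i)))"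
        by (rule sum.reindex_bij_betw[OF e, symmetric])
      also have "\<dots> = ennreal (\<Sum>i<card F. \<bar>g (r (e i)) - g (l (e i))\<bar>)"
        by (simp add: emT)
      also have "\<dots> \<le> ennreal \<epsilon>"
        using \<delta>(2)[of "card F" "\<lambda>i. l (e i)" "\<lambda>i. r (e i)", OF _ _ disj sum] cond
        by (intro ennreal_leI) simp
      finally show ?thesis .
    qed
    have "emeasure lborel (\<Union>K\<in>\<D>. T K) \<le> ennreal \<epsilon>"
    proof (cases "\<D> = {}")
      case False
      define A where "A n = (\<Union>K\<in>from_nat_into \<D> ` {..<n}. T K)" for n :: nat
      have "(SUP n. emeasure lborel (A n)) = emeasure lborel (\<Union>n. A n)"
      proof (rule SUP_emeasure_incseq)
        show "incseq A" unfolding A_def by (intro monoI UN_mono image_mono) auto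
      qed (auto simp: A_def T_def)
      moreover have "(\<Union>n. A n) = (\<Union>K\<in>range (from_nat_into \<D>). T K)" by (auto simp: A_def)
      moreover have "range (from_nat_into \<D>) = \<D>" using False \<D>(1) by simp
      moreover have "(SUP n. emeasure lborel (A n)) \<le> ennreal \<epsilon>"
        unfolding A_def using False by (intro SUP_least fin) (auto intro: from_nat_into)
      ultimately show ?thesis by simp
    qed simp
    moreover have "emeasure lborel (g ` S) \<le> emeasure lborel (\<Union>K\<in>\<D>. T K)"
    proof (rule emeasure_mono)
      show "g ` S \<subseteq> (\<Union>K\<in>\<D>. T K)" using \<D>(6) T by blast
      show "(\<Union>K\<in>\<D>. T K) \<in> sets lborel" using \<D>(1) by (intro sets.countable_UN') (auto simp: T_def)
    qed
    ultimately show ?thesis by (metis add_0 order_trans)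
  qed
  have "emeasure lborel (g ` S) \<le> 0" by (rule ennreal_le_epsilon) (rule le_eps)
  with assms(6) show ?thesis by auto
qed

lemma abs_cont_bij_monotone:
  assumes "bij g" "\<And>a b. abs_cont_on g {a..b}"
  shows "strict_mono g \<or> strict_antimono_on UNIV g"
proof -
  have "continuous_on UNIV g"
    using abs_cont_on_imp_isCont[OF assms(2)] by (simp add: continuous_on_eq_continuous_at)
  then show ?thesis
    using injective_eq_monotone_map[of UNIV g] bij_is_inj[OF assms(1)] by simp
qed

lemma abs_cont_nonsingular_inv:
  assumes "bij g" "\<And>a b. abs_cont_on g {a..b}"
  shows "nonsingular (inv g)"
  unfolding nonsingular_def
proof (intro conjI ballI)
  note mono = abs_cont_bij_monotone[OF assms]
  show meas: "inv g \<in> borel_measurable borel"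
    using strict_mono_or_antimono_inv[OF mono assms(1)] by (rule strict_mono_or_antimono_borel)
  fix N :: "real set" assume N: "N \<in> null_sets lborel"
  have eq: "inv g -` B = g ` B" for B
    using assms(1) by (simp add: bij_vimage_eq_inv_image bij_imp_bij_inv inv_inv_eq)
  \<comment> \<open>Preimages under \<open>inv g\<close> are images under \<open>g\<close>, and
    condition (N) is available on compact intervals; \<open>Suc k\<close> keeps these
    nondegenerate.\<close>
  have "g ` (N \<inter> {- real (Suc k)..real (Suc k)}) \<in> null_sets lborel" for k
  proof (rule abs_cont_on_null_image[OF mono assms(2), of "- real (Suc k)" "real (Suc k)"])
    show "N \<inter> {- real (Suc k)..real (Suc k)} \<in> null_sets lborel"
      using N by (intro null_set_Int2) auto
    then have "inv g -` (N \<inter> {- real (Suc k)..real (Suc k)}) \<in> sets borel"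
      using measurable_sets[OF meas] by fastforce
    then show "g ` (N \<inter> {- real (Suc k)..real (Suc k)}) \<in> sets borel" unfolding eq .
  qed auto
  then have "(\<Union>k. g ` (N \<inter> {- real (Suc k)..real (Suc k)})) \<in> null_sets lborel" by (rule null_sets_UN)
  moreover have "N = (\<Union>k. N \<inter> {- real (Suc k)..real (Suc k)})"
  proof -
    have "\<exists>k. x \<in> {- real (Suc k)..real (Suc k)}" for x :: real
    proof -
      obtain k where "\<bar>x\<bar> \<le> real k" using real_arch_simple by blast
      then show ?thesis by (intro exI[of _ k]) auto
    qed
    then show ?thesis by blast
  qed
  ultimately show "inv g -` N \<in> null_sets lborel"
    unfolding eq by (metis image_UN)
qed

section \<open>Isometries induced by homeomorphisms of the circle\<close>

text \<open>An increasing bijection only reparametrises the distribution functions. A decreasing one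
  also replaces them by one minus themselves, which changes the sign of the difference and swaps the
  two suprema.\<close>

lemma kuiper_distr_monotone:
  assumes "strict_mono h \<or> strict_antimono_on UNIV h" "bij h" "\<mu> \<in> Pac" "\<nu> \<in> Pac"
  shows "kuiper (distr \<mu> borel h) (distr \<nu> borel h) = kuiper \<mu> \<nu>"
proof -
  note h = strict_mono_or_antimono_borel[OF assms(1)]
  have surj: "range (inv h) = UNIV" using assms(2) by (intro bij_is_surj bij_imp_bij_inv)
  have reindex: "(SUP t. F (inv h t)) = (SUP t. F t)" for F :: "real \<Rightarrow> real"
    using surj by (metis image_image)
  have hinv: "h (inv h t) = t" for t using assms(2) by (simp add: bij_is_surj surj_f_inv_f)
  from assms(1) show ?thesis
  proof
    assume mono: "strict_mono h"
    have "distr_fun (distr m borel h) t = distr_fun m (inv h t)" if "m \<in> Pac" for m t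
    proof -
      have "h x \<le> t \<longleftrightarrow> x \<le> inv h t" for x
        using strict_mono_less_eq[OF mono, of x "inv h t"] by (simp add: hinv)
      then have "h -` {..t} = {..inv h t}" by auto
      then show ?thesis by (simp add: distr_fun_def measure_distr_Pac[OF that h])
    qed
    then show ?thesis
      using assms(3,4) reindex[of "\<lambda>t. distr_fun \<mu> t - distr_fun \<nu> t"] reindex[of "\<lambda>t. distr_fun \<nu> t - distr_fun \<mu> t"]
      by (simp add: kuiper_def)
  next
    assume anti: "strict_antimono_on UNIV h"
    then have anti': "h y < h x" if "x < y" for x y using that by (simp add: monotone_on_def)
    have le: "h x \<le> t \<longleftrightarrow> inv h t \<le> x" for x t
    proof (cases x "inv h t" rule: linorder_cases)
      case less
      with anti'[OF less] have "t < h x" by (simp add: hinv)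
      with less show ?thesis by auto
    next
      case greater
      with anti'[OF greater] have "h x < t" by (simp add: hinv)
      with greater show ?thesis by auto
    qed (simp add: hinv)
    have "distr_fun (distr m borel h) t = 1 - distr_fun m (inv h t)" if m: "m \<in> Pac" for m t
    proof -
      have "h -` {..t} = {inv h t..}" by (auto simp: le)
      then have "distr_fun (distr m borel h) t = measure m {inv h t..}"
        by (simp add: distr_fun_def measure_distr_Pac[OF m h])
      also have "\<dots> = measure m {inv h t<..}"
        by (rule measure_cong_off_null[OF m, of "{inv h t}"]) auto
      finally show ?thesis by (simp add: Pac_Ioi[OF m] distr_fun_def)
    qed
    then show ?thesis
      using assms(3,4) reindex[of "\<lambda>t. distr_fun \<mu> t - distr_fun \<nu> t"] reindex[of "\<lambda>t. distr_fun \<nu> t - distr_fun \<mu> t"]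
      by (simp add: kuiper_def)
  qed
qed

text \<open>Up to finitely many points, \<open>1 / x \<le> t\<close> describes the arc from
  \<open>1 / t\<close> to 0, which passes through infinity if \<open>t\<close> is positive. At
  \<open>t = 0\<close> the arc starts at infinity, hence the separate clause.\<close>

lemma distr_fun_distr_inverse:
  assumes "\<mu> \<in> Pac"
  shows "distr_fun (distr \<mu> borel (\<lambda>x. 1 / x)) t =
    (if t > 0 then distr_fun \<mu> 0 + 1 - distr_fun \<mu> (1 / t)
     else if t < 0 then distr_fun \<mu> 0 - distr_fun \<mu> (1 / t) else distr_fun \<mu> 0)"
proof -
  have "distr_fun (distr \<mu> borel (\<lambda>x. 1 / x)) t = measure \<mu> ((\<lambda>x. 1 / x) -` {..t})"
    unfolding distr_fun_def using assms by (intro measure_distr_Pac) auto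
  also have "\<dots> = (if t > 0 then distr_fun \<mu> 0 + 1 - distr_fun \<mu> (1 / t)
     else if t < 0 then distr_fun \<mu> 0 - distr_fun \<mu> (1 / t) else distr_fun \<mu> 0)"
  proof (cases t "0 :: real" rule: linorder_cases)
    case less
    have "measure \<mu> ((\<lambda>x. 1 / x) -` {..t}) = measure \<mu> {1 / t<..0}"
    proof (rule measure_cong_off_null[OF assms, of "{0, 1 / t}"])
      show "(\<lambda>x. 1 / x) -` {..t} \<in> sets borel"
        using measurable_sets[of "\<lambda>x::real. 1 / x" borel borel "{..t}"] by simp
      fix x assume x: "x \<notin> {0, 1 / t}"
      show "x \<in> (\<lambda>x. 1 / x) -` {..t} \<longleftrightarrow> x \<in> {1 / t<..0}"
      proof (cases "x < 0")
        case True
        then show ?thesis using x less by (auto simp: field_simps)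
      next
        case False
        then have "0 \<le> 1 / x" by simp
        then have "\<not> 1 / x \<le> t" using less by linarith
        then show ?thesis using False x by simp
      qed
    qed (auto intro: finite_imp_null_set_lborel)
    then show ?thesis using less Pac_Ioc[OF assms, of "1 / t" 0] by (simp add: distr_fun_def divide_le_0_iff)
  next
    case equal
    have "(\<lambda>x. 1 / x) -` {..t} = {..0}" by (auto simp: equal)
    then show ?thesis by (simp add: equal distr_fun_def)
  next
    case greater
    have "measure \<mu> ((\<lambda>x. 1 / x) -` {..t}) = measure \<mu> ({..0} \<union> {1 / t<..})"
    proof (rule measure_cong_off_null[OF assms, of "{0, 1 / t}"])
      show "(\<lambda>x. 1 / x) -` {..t} \<in> sets borel"
        using measurable_sets[of "\<lambda>x::real. 1 / x" borel borel "{..t}"] by simp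
      fix x assume x: "x \<notin> {0, 1 / t}"
      show "x \<in> (\<lambda>x. 1 / x) -` {..t} \<longleftrightarrow> x \<in> {..0} \<union> {1 / t<..}"
      proof (cases "0 < x")
        case True
        then show ?thesis using x greater by (auto simp: field_simps)
      next
        case False
        then have "1 / x \<le> 0" by simp
        then have "1 / x \<le> t" using greater by linarith
        then show ?thesis using False by simp
      qed
    qed (auto intro: finite_imp_null_set_lborel)
    also have "\<dots> = measure \<mu> {..0} + measure \<mu> {1 / t<..}"
    proof (rule Pac_Un_disjoint[OF assms])
      have "{..0} \<inter> {c<..} = {}" if "0 < c" for c :: real using that by auto
      then show "{..0} \<inter> {1 / t<..} = {}" using greater by simp
    qed auto
    finally show ?thesis using greater by (simp add: distr_fun_def Pac_Ioi[OF assms])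
  qed
  finally show ?thesis .
qed

lemma nonsingular_inverse: "nonsingular (\<lambda>x. 1 / x)"
  using nonsingular_r_map[of "Some 0"] by (simp add: r_map_def[abs_def])

text \<open>Inversion turns the difference \<open>D\<close> into \<open>D 0 - D (1 / t)\<close>: a
  reparametrisation of the circle, a change of sign and an added constant, none of which affects the
  oscillation. As inversion is an involution, one inequality suffices.\<close>

lemma kuiper_distr_inverse:
  assumes "\<mu> \<in> Pac" "\<nu> \<in> Pac"
  shows "kuiper (distr \<mu> borel (\<lambda>x. 1 / x)) (distr \<nu> borel (\<lambda>x. 1 / x)) = kuiper \<mu> \<nu>"
proof -
  have le: "kuiper (distr \<mu> borel (\<lambda>x. 1 / x)) (distr \<nu> borel (\<lambda>x. 1 / x)) \<le> kuiper \<mu> \<nu>"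
    if "\<mu> \<in> Pac" "\<nu> \<in> Pac" for \<mu> \<nu>
  proof -
    define D where "D t = distr_fun \<mu> t - distr_fun \<nu> t" for t
    define D' where "D' t = distr_fun (distr \<mu> borel (\<lambda>x. 1 / x)) t - distr_fun (distr \<nu> borel (\<lambda>x. 1 / x)) t" for t
    have D': "D' t = (if t = 0 then D 0 else D 0 - D (1 / t))" for t
      unfolding D_def D'_def by (simp add: distr_fun_distr_inverse that)
    have D1: "\<bar>D t\<bar> \<le> kuiper \<mu> \<nu>" and D2: "\<bar>D t - D s\<bar> \<le> kuiper \<mu> \<nu>" for s t
      unfolding D_def using kuiper_ge[OF that] by blast+
    note P = distr_Pac[OF nonsingular_inverse that(1)] distr_Pac[OF nonsingular_inverse that(2)]
    show ?thesis
    proof (rule kuiper_attained[OF P])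
      assume "kuiper (distr \<mu> borel (\<lambda>x. 1 / x)) (distr \<nu> borel (\<lambda>x. 1 / x)) = 0"
      then show ?thesis using D1[of 0] by linarith
    next
      fix t assume "kuiper (distr \<mu> borel (\<lambda>x. 1 / x)) (distr \<nu> borel (\<lambda>x. 1 / x)) =
        \<bar>distr_fun (distr \<mu> borel (\<lambda>x. 1 / x)) t - distr_fun (distr \<nu> borel (\<lambda>x. 1 / x)) t\<bar>"
      then have "kuiper (distr \<mu> borel (\<lambda>x. 1 / x)) (distr \<nu> borel (\<lambda>x. 1 / x)) = \<bar>D' t\<bar>"
        by (simp add: D'_def)
      then show ?thesis using D1[of 0] D2[of 0 "1 / t"] by (simp add: D' split: if_splits)
    next
      fix t s assume "kuiper (distr \<mu> borel (\<lambda>x. 1 / x)) (distr \<nu> borel (\<lambda>x. 1 / x)) =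
        distr_fun (distr \<mu> borel (\<lambda>x. 1 / x)) t - distr_fun (distr \<nu> borel (\<lambda>x. 1 / x)) t -
        (distr_fun (distr \<mu> borel (\<lambda>x. 1 / x)) s - distr_fun (distr \<nu> borel (\<lambda>x. 1 / x)) s)"
      then have "kuiper (distr \<mu> borel (\<lambda>x. 1 / x)) (distr \<nu> borel (\<lambda>x. 1 / x)) = D' t - D' s"
        by (simp add: D'_def)
      then show ?thesis
        using D1[of 0] D1[of "1 / t"] D1[of "1 / s"] D2[of "1 / s" "1 / t"]
        by (cases "t = 0"; cases "s = 0") (simp_all add: D')
    qed
  qed
  have inv: "distr (distr m borel (\<lambda>x. 1 / x)) borel (\<lambda>x. 1 / x) = m" if "m \<in> Pac" for m :: "real measure"
    using that by (intro distr_inverse_Pac) auto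
  show ?thesis
    using le[OF assms] le[OF assms[THEN distr_Pac[OF nonsingular_inverse]]] by (simp add: inv assms)
qed

lemma kuiper_distr_r_map:
  assumes "\<mu> \<in> Pac" "\<nu> \<in> Pac"
  shows "kuiper (distr \<mu> borel (r_map x)) (distr \<nu> borel (r_map x)) = kuiper \<mu> \<nu>"
proof (cases x)
  case None
  then have "r_map x = (\<lambda>t. t)" by (simp add: r_map_def[abs_def])
  then show ?thesis using assms by (simp add: distr_id_Pac)
next
  case (Some y)
  have bij: "bij (\<lambda>t. t - y)" by (rule o_bij[of "\<lambda>t. t + y"]) auto
  have mono: "strict_mono (\<lambda>t. t - y)" by (simp add: strict_mono_def)
  have ns: "nonsingular (\<lambda>t. t - y)"
    by (rule nonsingular_differentiable_inverse[of _ "\<lambda>t. t + y" "{}"])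
      (auto simp: differentiable_on_def intro!: derivative_intros)
  have r: "distr m borel (r_map x) = distr (distr m borel (\<lambda>t. t - y)) borel (\<lambda>t. 1 / t)"
    if "m \<in> Pac" for m :: "real measure"
    using that by (subst distr_distr_Pac) (auto simp: Some r_map_def[abs_def] comp_def)
  show ?thesis
    using kuiper_distr_inverse[OF assms[THEN distr_Pac[OF ns]]]
      kuiper_distr_monotone[OF disjI1[OF mono] bij assms]
    by (simp add: r assms)
qed

lemma kuiper_distr_r_inv:
  assumes "\<mu> \<in> Pac" "\<nu> \<in> Pac"
  shows "kuiper (distr \<mu> borel (r_inv x)) (distr \<nu> borel (r_inv x)) = kuiper \<mu> \<nu>"
proof -
  have "distr (distr m borel (r_inv x)) borel (r_map x) = m" if "m \<in> Pac" for m
    using that by (intro distr_inverse_Pac) (auto simp: r_inv_r_map)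
  then show ?thesis
    using kuiper_distr_r_map[OF assms[THEN distr_Pac[OF nonsingular_r_inv[of x]]], of x] assms by simp
qed

section \<open>Composition with a map as a push-forward by its inverse\<close>

lemma comp_measure_eq_distr:
  assumes "\<mu> \<in> Pac" "T \<in> borel_measurable borel" "\<And>y. T (G y) = y" "\<And>y. G (T y) = y" "finite (- A)"
  shows "comp_measure \<mu> A G = distr \<mu> borel T"
proof -
  have A: "A \<in> sets borel"
    using assms(5) borel_comp[of "- A"] finite_imp_closed[of "- A"] by auto
  have "emeasure \<mu> (G ` (B \<inter> A)) = emeasure (distr \<mu> borel T) B" if B: "B \<in> sets borel" for B
  proof -
    have eq: "G ` C = T -` C" for C
    proof (intro equalityI subsetI)
      fix y assume "y \<in> T -` C"
      then show "y \<in> G ` C" using assms(4)[of y] by (intro image_eqI[of _ _ "T y"]) auto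
    qed (use assms(3) in auto)
    have T: "T -` C \<in> sets \<mu>" if "C \<in> sets borel" for C
      using measurable_sets[OF assms(2) that] Pac_sets[OF assms(1)] by simp
    \<comment> \<open>The restriction to \<open>A\<close> discards only a finite set, which is null
      for \<mu>.\<close>
    have "finite (T -` (- A))" using assms(5) by (simp add: eq[symmetric])
    then have "T -` (- A) \<in> null_sets \<mu>"
      using finite_imp_null_set_lborel assms(1) by (auto simp: Pac_def absolutely_continuous_def)
    then have "emeasure \<mu> (T -` B - T -` (- A)) = emeasure \<mu> (T -` B)"
      by (intro emeasure_Diff_null_set T B)
    moreover have "T -` B - T -` (- A) = G ` (B \<inter> A)" unfolding eq by auto
    ultimately show ?thesis using measure_distr_Pac(2)[OF assms(1,2) B] by simp
  qed
  then have "comp_measure \<mu> A G = measure_of UNIV (sets borel) (emeasure (distr \<mu> borel T))"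
    unfolding comp_measure_def
    by (intro measure_of_eq) (auto simp: sets.sigma_sets_eq[of borel, simplified])
  also have "\<dots> = distr \<mu> borel T"
    using measure_of_of_measure[of "distr \<mu> borel T"] by simp
  finally show ?thesis .
qed

text \<open>With \<open>1 / 0 = 0\<close> the map \<open>g \<circ> r_map x\<close> is a bijection of
  the line with inverse \<open>r_inv x \<circ> inv g\<close>; the artificial value at a pole sits
  outside \<open>r_dom x\<close>.\<close>

lemma comp_measure_r_map:
  assumes "bij g" "inv g \<in> borel_measurable borel" "\<mu> \<in> Pac"
  shows "comp_measure \<mu> (r_dom x) (g \<circ> r_map x) = distr \<mu> borel (r_inv x \<circ> inv g)"
proof (rule comp_measure_eq_distr[OF assms(3)])
  show "finite (- r_dom x)" by (cases x) (auto simp: r_dom_def)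
  show "r_inv x \<circ> inv g \<in> borel_measurable borel" using assms(2) by measurable
qed (use assms(1) in \<open>auto simp: r_inv_r_map bij_is_inj bij_is_surj surj_f_inv_f\<close>)

theorem theorem1p2:
  shows "(\<forall>\<phi> :: real measure \<Rightarrow> real measure.
            \<phi> ` Pac = Pac \<and> (\<forall>\<mu>\<in>Pac. \<forall>\<nu>\<in>Pac. kuiper (\<phi> \<mu>) (\<phi> \<nu>) = kuiper \<mu> \<nu>)
            \<longrightarrow> (\<exists>(g :: real \<Rightarrow> real) (x :: real option).
                   bij g \<and> (\<forall>a b. abs_cont_on g {a..b}) \<and> (\<forall>a b. abs_cont_on (inv g) {a..b}) \<and>
                   (\<forall>\<mu>\<in>Pac. \<phi> \<mu> = comp_measure \<mu> (r_dom x) (g \<circ> r_map x))))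
       \<and>
       (\<forall>(g :: real \<Rightarrow> real) (x :: real option).
            bij g \<and> (\<forall>a b. abs_cont_on g {a..b}) \<and> (\<forall>a b. abs_cont_on (inv g) {a..b})
            \<longrightarrow> (\<lambda>\<mu>. comp_measure \<mu> (r_dom x) (g \<circ> r_map x)) ` Pac = Pac \<and>
                (\<forall>\<mu>\<in>Pac. \<forall>\<nu>\<in>Pac.
                   kuiper (comp_measure \<mu> (r_dom x) (g \<circ> r_map x)) (comp_measure \<nu> (r_dom x) (g \<circ> r_map x))
                   = kuiper \<mu> \<nu>))"
proof (rule conjI; intro allI impI)
  fix \<phi> :: "real measure \<Rightarrow> real measure"
  assume "\<phi> ` Pac = Pac \<and> (\<forall>\<mu>\<in>Pac. \<forall>\<nu>\<in>Pac. kuiper (\<phi> \<mu>) (\<phi> \<nu>) = kuiper \<mu> \<nu>)"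
  then interpret kuiper_isometry \<phi> by unfold_locales auto
  obtain x h where h: "strict_mono h \<or> strict_antimono_on UNIV h" "bij h" "nonsingular h" "nonsingular (inv h)"
    and \<phi>: "\<And>\<mu>. \<mu> \<in> Pac \<Longrightarrow> \<phi> \<mu> = distr \<mu> borel (r_inv x \<circ> h)"
    using phi_distr by blast
  \<comment> \<open>A push-forward takes preimages and \<open>comp_measure\<close> takes images, so
    the \<open>g\<close> sought is \<open>inv h\<close>.\<close>
  have inv_inv: "inv (inv h) = h" using h(2) by (rule inv_inv_eq)
  have "abs_cont_on (inv h) {a..b}" for a b
    using h(1,2,3) by (rule nonsingular_imp_abs_cont_inv)
  moreover have "abs_cont_on (inv (inv h)) {a..b}" for a b
    using strict_mono_or_antimono_inv[OF h(1,2)] bij_imp_bij_inv[OF h(2)] h(4)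
    by (rule nonsingular_imp_abs_cont_inv)
  moreover have "\<phi> \<mu> = comp_measure \<mu> (r_dom x) (inv h \<circ> r_map x)" if "\<mu> \<in> Pac" for \<mu>
    using comp_measure_r_map[OF bij_imp_bij_inv[OF h(2)] _ that, of x] nonsingular_measurable[OF h(3)] \<phi>[OF that]
    by (simp add: inv_inv)
  ultimately show "\<exists>(g :: real \<Rightarrow> real) (x :: real option).
      bij g \<and> (\<forall>a b. abs_cont_on g {a..b}) \<and> (\<forall>a b. abs_cont_on (inv g) {a..b}) \<and>
      (\<forall>\<mu>\<in>Pac. \<phi> \<mu> = comp_measure \<mu> (r_dom x) (g \<circ> r_map x))"
    using bij_imp_bij_inv[OF h(2)] by (intro exI[of _ "inv h"] exI[of _ x] conjI allI ballI)
next
  fix g :: "real \<Rightarrow> real" and x :: "real option"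
  assume g: "bij g \<and> (\<forall>a b. abs_cont_on g {a..b}) \<and> (\<forall>a b. abs_cont_on (inv g) {a..b})"
  then have "bij g" and bij: "bij (inv g)" by (auto intro: bij_imp_bij_inv)
  have ns: "nonsingular (inv g)" "nonsingular g"
    using abs_cont_nonsingular_inv[of g] abs_cont_nonsingular_inv[of "inv g"] g bij by (auto simp: inv_inv_eq)
  have mono: "strict_mono (inv g) \<or> strict_antimono_on UNIV (inv g)"
    using abs_cont_bij_monotone[OF bij] g by blast
  let ?T = "\<lambda>\<mu>. comp_measure \<mu> (r_dom x) (g \<circ> r_map x)"
  have T: "?T \<mu> = distr (distr \<mu> borel (inv g)) borel (r_inv x)" if "\<mu> \<in> Pac" for \<mu>
    using comp_measure_r_map[OF \<open>bij g\<close> nonsingular_measurable[OF ns(1)] that, of x]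
    by (simp add: distr_distr_Pac[OF _ nonsingular_measurable[OF ns(1)] that])
  show "?T ` Pac = Pac \<and> (\<forall>\<mu>\<in>Pac. \<forall>\<nu>\<in>Pac. kuiper (?T \<mu>) (?T \<nu>) = kuiper \<mu> \<nu>)"
  proof (intro conjI ballI)
    show "?T ` Pac = Pac"
    proof (intro equalityI subsetI)
      fix \<nu> assume \<nu>: "\<nu> \<in> Pac"
      \<comment> \<open>A preimage of \<nu> arises by undoing \<open>r_inv x\<close> with
        \<open>r_map x\<close> and then \<open>inv g\<close> with \<open>g\<close>.\<close>
      have r\<nu>: "distr \<nu> borel (r_map x) \<in> Pac" using nonsingular_r_map \<nu> by (rule distr_Pac)
      have "distr (distr (distr \<nu> borel (r_map x)) borel g) borel (inv g) = distr \<nu> borel (r_map x)"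
        using ns r\<nu> \<open>bij g\<close> by (intro distr_inverse_Pac) (auto simp: nonsingular_def bij_is_inj)
      moreover have "distr (distr \<nu> borel (r_map x)) borel (r_inv x) = \<nu>"
        using \<nu> by (intro distr_inverse_Pac) (auto simp: r_inv_r_map)
      moreover have P: "distr (distr \<nu> borel (r_map x)) borel g \<in> Pac" using ns(2) r\<nu> by (rule distr_Pac)
      ultimately have "?T (distr (distr \<nu> borel (r_map x)) borel g) = \<nu>" by (simp add: T)
      then show "\<nu> \<in> ?T ` Pac" using P by (metis imageI)
    qed (auto simp: T intro: distr_Pac ns nonsingular_r_inv)
    fix \<mu> \<nu> assume P: "\<mu> \<in> Pac" "\<nu> \<in> Pac"
    show "kuiper (?T \<mu>) (?T \<nu>) = kuiper \<mu> \<nu>"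
      by (simp add: T P kuiper_distr_r_inv distr_Pac ns kuiper_distr_monotone[OF mono bij])
  qed
qed

end
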